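(* Let $G$ and $G^*$ be countable graphs, each finitely separable, defined on the same edge set $E$, such that $G^*$ is a dual of $G$ with the identity map $E\to E$ as witnessing bijection. Then $$M_{\rm FB}(G)=M_{\rm C}^*(G)=M_{\rm B}^*(G^* )=M_{\rm FC}(G^* ).$$
   Context: Matroids may be infinite (defined by: $\emptyset$ independent; independent sets closed under subsets; for a non-maximal independent $I$ and maximal independent $I'$ some $x\in I'\setminus I$ has $I\cup\{x\}$ independent; and for every independent $I\subseteq X\subseteq E$ there is a maximal independent set $I'$ with $I\subseteq I'\subseteq X$). Circuits are minimal dependent sets; $M^*$ denotes the dual matroid, whose bases are the complements of the bases of $M$. Graphs may have parallel edges and loops. A graph is finitely separable if any two vertices can be separated by removing finitely many edges. A cut is the set of edges across a partition of the vertex set; a bond is a minimal non-empty cut. $M_{\rm FC}(H)$: the matroid on $E(H)$ whose circuits are the edge sets of finite cycles of $H$. $M_{\rm FB}(H)$: circuits are the finite bonds of $H$. $M_{\rm B}(H)$: circuits are all bonds of $H$. $M_{\rm C}(H)$: circuits are the edge sets of circles in $|H|$. The space $|H|$: rays are one-way infinite paths; two rays are edge-equivalent if for every finite edge set $F$ some component of $H-F$ contains subrays of both; classes are edge-ends. Viewing edges as copies of $[0,1]$ glued at common vertices gives a space $X_H$; $|H|$ has point set $X_H$ together with the edge-ends, and its open sets are unions of sets $\widetilde C$, where $C$ is a component of $X_H\setminus Z$ for a finite set $Z$ of inner points of edges and $\widetilde C$ adds to $C$ the edge-ends having a ray in $C$. A circle is a subspace homeomorphic to $S^1$; its edge set is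 the set of edges all of whose inner points lie in it. A graph $G^*$ is a dual of $G$ if there is a bijection ${}^*:E(G)\to E(G^* )$ such that $F\subseteq E(G)$ is the edge set of a circle in $|G|$ if and only if $\{e^*: e\in F\}$ is a bond of $G^*$. *)

theory Defs
  imports "HOL-Analysis.Analysis"
begin

record ('v, 'e) graph =
  verts :: "'v set"
  edges :: "'e set"
  ends  :: "'e \<Rightarrow> 'v \<times> 'v"

definition wf_graph :: "('v, 'e) graph \<Rightarrow> bool" where
  "wf_graph G \<longleftrightarrow> (\<forall>e\<in>edges G. fst (ends G e) \<in> verts G \<and> snd (ends G e) \<in> verts G)"

definition countable_graph :: "('v, 'e) graph \<Rightarrow> bool" where
  "countable_graph G \<longleftrightarrow> countable (verts G) \<and> countable (edges G)"

definition adj_avoid :: "('v, 'e) graph \<Rightarrow> 'e set \<Rightarrow> 'v \<Rightarrow> 'v \<Rightarrow> bool" where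
  "adj_avoid G F u v \<longleftrightarrow> (\<exists>e. e \<in> edges G - F \<and> (ends G e = (u, v) \<or> ends G e = (v, u)))"

definition finitely_separable :: "('v, 'e) graph \<Rightarrow> bool" where
  "finitely_separable G \<longleftrightarrow>
     (\<forall>u\<in>verts G. \<forall>v\<in>verts G. u \<noteq> v \<longrightarrow>
        (\<exists>F. finite F \<and> F \<subseteq> edges G \<and> \<not> (adj_avoid G F)\<^sup>*\<^sup>* u v))"

definition cut :: "('v, 'e) graph \<Rightarrow> 'v set \<Rightarrow> 'e set" where
  "cut G A = {e \<in> edges G. (fst (ends G e) \<in> A) \<noteq> (snd (ends G e) \<in> A)}"

definition is_cut :: "('v, 'e) graph \<Rightarrow> 'e set \<Rightarrow> bool" where
  "is_cut G D \<longleftrightarrow> (\<exists>A. A \<subseteq> verts G \<and> D = cut G A)"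

definition is_bond :: "('v, 'e) graph \<Rightarrow> 'e set \<Rightarrow> bool" where
  "is_bond G D \<longleftrightarrow> is_cut G D \<and> D \<noteq> {} \<and>
     (\<forall>D'. is_cut G D' \<and> D' \<noteq> {} \<and> D' \<subseteq> D \<longrightarrow> D' = D)"

definition deg_in :: "('v, 'e) graph \<Rightarrow> 'e set \<Rightarrow> 'v \<Rightarrow> nat" where
  "deg_in G F v = card {e \<in> F. fst (ends G e) = v} + card {e \<in> F. snd (ends G e) = v}"

text \<open>Edge sets of finite cycles: finite non-empty edge sets forming a connected
  2-regular subgraph (this includes loops and pairs of parallel edges).\<close>
definition is_finite_cycle :: "('v, 'e) graph \<Rightarrow> 'e set \<Rightarrow> bool" where
  "is_finite_cycle G F \<longleftrightarrow> finite F \<and> F \<noteq> {} \<and> F \<subseteq> edges G \<and>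
     (\<forall>v\<in>verts G. deg_in G F v = 0 \<or> deg_in G F v = 2) \<and>
     (\<forall>u v. deg_in G F u > 0 \<and> deg_in G F v > 0 \<longrightarrow> (adj_avoid G (edges G - F))\<^sup>*\<^sup>* u v)"

type_synonym ('v, 'e) ray = "(nat \<Rightarrow> 'v) \<times> (nat \<Rightarrow> 'e)"

definition is_ray :: "('v, 'e) graph \<Rightarrow> ('v, 'e) ray \<Rightarrow> bool" where
  "is_ray G \<rho> \<longleftrightarrow> inj (fst \<rho>) \<and>
     (\<forall>i. fst \<rho> i \<in> verts G \<and> snd \<rho> i \<in> edges G \<and>
          (ends G (snd \<rho> i) = (fst \<rho> i, fst \<rho> (Suc i)) \<or>
           ends G (snd \<rho> i) = (fst \<rho> (Suc i), fst \<rho> i)))"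

definition ray_equiv :: "('v, 'e) graph \<Rightarrow> ('v, 'e) ray \<Rightarrow> ('v, 'e) ray \<Rightarrow> bool" where
  "ray_equiv G \<rho>1 \<rho>2 \<longleftrightarrow>
     (\<forall>F. finite F \<and> F \<subseteq> edges G \<longrightarrow>
        (\<exists>n m. (\<forall>k\<ge>n. snd \<rho>1 k \<notin> F) \<and> (\<forall>k\<ge>m. snd \<rho>2 k \<notin> F) \<and>
               (adj_avoid G F)\<^sup>*\<^sup>* (fst \<rho>1 n) (fst \<rho>2 m)))"

definition edge_ends :: "('v, 'e) graph \<Rightarrow> ('v, 'e) ray set set" where
  "edge_ends G = {{\<rho>'. is_ray G \<rho>' \<and> ray_equiv G \<rho> \<rho>'} | \<rho>. is_ray G \<rho>}"

text \<open>Points: vertices, inner points of edges (\<open>PE e t\<close>, \<open>0 < t < 1\<close>, where \<open>t \<rightarrow> 0\<close>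
  approaches the first end of \<open>e\<close>), and edge-ends.\<close>
datatype ('v, 'e) pt = PV 'v | PE 'e real | PEnd "('v, 'e) ray set"

definition inner_points :: "('v, 'e) graph \<Rightarrow> ('v, 'e) pt set" where
  "inner_points G = {PE e t | e t. e \<in> edges G \<and> 0 < t \<and> t < 1}"

definition XH :: "('v, 'e) graph \<Rightarrow> ('v, 'e) pt set" where
  "XH G = PV ` verts G \<union> inner_points G"

definition edge_map :: "('v, 'e) graph \<Rightarrow> 'e \<Rightarrow> real \<Rightarrow> ('v, 'e) pt" where
  "edge_map G e t = (if t = 0 then PV (fst (ends G e))
                     else if t = 1 then PV (snd (ends G e)) else PE e t)"

text \<open>\<open>X_G\<close> carries the quotient (weak) topology of the disjoint union of the edges
  \<open>[0,1]\<close> and the vertices: a set is open iff its preimage in each edge is open.\<close>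
definition XH_open :: "('v, 'e) graph \<Rightarrow> ('v, 'e) pt set \<Rightarrow> bool" where
  "XH_open G U \<longleftrightarrow> U \<subseteq> XH G \<and>
     (\<forall>e\<in>edges G. openin (top_of_set {0..1::real}) {t \<in> {0..1}. edge_map G e t \<in> U})"

lemma istopology_XH_open: "istopology (XH_open G)"
proof -
  have int: "XH_open G (S \<inter> T)" if "XH_open G S" "XH_open G T" for S T
  proof -
    have "{t \<in> {0..1::real}. edge_map G e t \<in> S \<inter> T} =
          {t \<in> {0..1}. edge_map G e t \<in> S} \<inter> {t \<in> {0..1}. edge_map G e t \<in> T}" for e
      by auto
    then show ?thesis using that unfolding XH_open_def by (auto intro: openin_Int)
  qed
  have un: "XH_open G (\<Union>K)" if "\<forall>S\<in>K. XH_open G S" for K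
  proof -
    have "{t \<in> {0..1::real}. edge_map G e t \<in> \<Union>K} =
          (\<Union>S\<in>K. {t \<in> {0..1}. edge_map G e t \<in> S})" for e
      by auto
    then show ?thesis using that unfolding XH_open_def by (auto intro!: openin_Union)
  qed
  show ?thesis unfolding istopology_def using int un by blast
qed

definition XH_top :: "('v, 'e) graph \<Rightarrow> ('v, 'e) pt topology" where
  "XH_top G = topology (XH_open G)"

definition ray_points :: "('v, 'e) graph \<Rightarrow> ('v, 'e) ray \<Rightarrow> ('v, 'e) pt set" where
  "ray_points G \<rho> = PV ` range (fst \<rho>) \<union> {PE (snd \<rho> i) t | i t. 0 < t \<and> t < 1}"

definition hat :: "('v, 'e) graph \<Rightarrow> ('v, 'e) pt set \<Rightarrow> ('v, 'e) pt set" where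
  "hat G C = C \<union> {PEnd \<omega> | \<omega>. \<omega> \<in> edge_ends G \<and> (\<exists>\<rho>\<in>\<omega>. ray_points G \<rho> \<subseteq> C)}"

definition basic_opens :: "('v, 'e) graph \<Rightarrow> ('v, 'e) pt set set" where
  "basic_opens G = {hat G C | C Z. finite Z \<and> Z \<subseteq> inner_points G \<and>
      C \<in> connected_components_of (subtopology (XH_top G) (XH G - Z))}"

text \<open>\<open>|G|\<close>: open sets are the unions of the sets \<open>\<tilde>C\<close>.\<close>
definition absG :: "('v, 'e) graph \<Rightarrow> ('v, 'e) pt topology" where
  "absG G = topology_generated_by (basic_opens G)"

definition is_circle :: "('v, 'e) graph \<Rightarrow> ('v, 'e) pt set \<Rightarrow> bool" where
  "is_circle G S \<longleftrightarrow> S \<subseteq> topspace (absG G) \<and>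
     subtopology (absG G) S homeomorphic_space top_of_set (sphere (0::complex) 1)"

definition circle_edges :: "('v, 'e) graph \<Rightarrow> ('v, 'e) pt set \<Rightarrow> 'e set" where
  "circle_edges G S = {e \<in> edges G. \<forall>t. 0 < t \<and> t < 1 \<longrightarrow> PE e t \<in> S}"

definition indep_of_circuits :: "'e set \<Rightarrow> 'e set set \<Rightarrow> 'e set set" where
  "indep_of_circuits E \<C> = {I. I \<subseteq> E \<and> \<not> (\<exists>C\<in>\<C>. C \<subseteq> I)}"

definition is_base :: "'e set set \<Rightarrow> 'e set \<Rightarrow> bool" where
  "is_base \<I> B \<longleftrightarrow> B \<in> \<I> \<and> (\<forall>I\<in>\<I>. B \<subseteq> I \<longrightarrow> I = B)"

definition dual_indep :: "'e set \<Rightarrow> 'e set set \<Rightarrow> 'e set set" where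
  "dual_indep E \<I> = {I. I \<subseteq> E \<and> (\<exists>B. is_base \<I> B \<and> I \<subseteq> E - B)}"

definition M_FC :: "('v, 'e) graph \<Rightarrow> 'e set set" where
  "M_FC G = indep_of_circuits (edges G) {F. is_finite_cycle G F}"

definition M_FB :: "('v, 'e) graph \<Rightarrow> 'e set set" where
  "M_FB G = indep_of_circuits (edges G) {D. is_bond G D \<and> finite D}"

definition M_B :: "('v, 'e) graph \<Rightarrow> 'e set set" where
  "M_B G = indep_of_circuits (edges G) {D. is_bond G D}"

definition M_C :: "('v, 'e) graph \<Rightarrow> 'e set set" where
  "M_C G = indep_of_circuits (edges G) {circle_edges G S | S. is_circle G S}"

definition is_dual_id :: "('v, 'e) graph \<Rightarrow> ('w, 'e) graph \<Rightarrow> bool" where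
  "is_dual_id G G' \<longleftrightarrow> edges G = edges G' \<and>
     (\<forall>F. F \<subseteq> edges G \<longrightarrow>
        ((\<exists>S. is_circle G S \<and> circle_edges G S = F) \<longleftrightarrow> is_bond G' F))"

end

(*
  Duality identifies the circles of G with the bonds of G', so the second equation is immediate.
  The bases of M_B(G') are the complements of the maximal spanning forests of G', which gives the
  third. It remains to compare the finite bonds of G with the finite cycles of G'.

  A finite cycle F of G' never meets a bond of G' in exactly one edge. If F contained no bond of G,
  the ends of an edge e of F would be joined by a path in G - F; path and e form a finite cycle of G,
  hence a circle, hence a bond of G' meeting F in e only. Conversely, a circle never meets a finite
  cut F of G in exactly one edge: cut every edge of F at one inner point, chosen off the circle
  whenever possible; removing a single point from the circle would then leave a connected set inside
  two disjoint open sets. If a finite bond F of G were acyclic in G', it would extend to a spanning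
  forest of G' whose fundamental bond at an edge of F is a circle meeting F in that edge only.
*)
theory Submission
  imports Defs
begin

section \<open>Spanning edge sets, bonds and finite cycles\<close>

text \<open>Walks are described by the edges they may use instead of those they avoid. The
  complement is taken in the whole edge type, since \<open>adj_avoid\<close> already restricts to
  \<open>edges G\<close>.\<close>

abbreviation linked :: "('v, 'e) graph \<Rightarrow> 'e set \<Rightarrow> 'v \<Rightarrow> 'v \<Rightarrow> bool" where
  "linked G T \<equiv> (adj_avoid G (- T))\<^sup>*\<^sup>*"

definition joins :: "('v, 'e) graph \<Rightarrow> 'e \<Rightarrow> 'v \<Rightarrow> 'v \<Rightarrow> bool" where
  "joins G e u v \<longleftrightarrow> e \<in> edges G \<and> (ends G e = (u, v) \<or> ends G e = (v, u))"

text \<open>For \<open>e\<close> in \<open>T\<close> this says that no cycle inside \<open>T\<close>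
  passes through \<open>e\<close>. Asking it of every edge of \<open>T\<close> makes
  \<open>T\<close> a forest, in a form that passes to unions of chains.\<close>

definition bridge :: "('v, 'e) graph \<Rightarrow> 'e set \<Rightarrow> 'e \<Rightarrow> bool" where
  "bridge G T e \<longleftrightarrow> \<not> linked G (T - {e}) (fst (ends G e)) (snd (ends G e))"

text \<open>Equivalently, \<open>T\<close> has the same components as \<open>G\<close>; this is the
  right notion for disconnected graphs.\<close>

definition spanning :: "('v, 'e) graph \<Rightarrow> 'e set \<Rightarrow> bool" where
  "spanning G T \<longleftrightarrow> (\<forall>e\<in>edges G. linked G T (fst (ends G e)) (snd (ends G e)))"

text \<open>Length 1 is a loop and length 2 a pair of parallel edges; injectivity of
  \<open>q\<close> rules out going back and forth along one edge.\<close>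

definition closed_path :: "('v, 'e) graph \<Rightarrow> (nat \<Rightarrow> 'v) \<Rightarrow> (nat \<Rightarrow> 'e) \<Rightarrow> nat \<Rightarrow> bool" where
  "closed_path G p q n \<longleftrightarrow> 0 < n \<and> p n = p 0 \<and> inj_on p {..<n} \<and> inj_on q {..<n} \<and>
     (\<forall>i<n. joins G (q i) (p i) (p (Suc i)))"

section \<open>Walks inside an edge set\<close>

lemma adj_avoid_compl: "adj_avoid G (- T) u v \<longleftrightarrow> (\<exists>e\<in>T. joins G e u v)"
  unfolding adj_avoid_def joins_def by auto

lemma linked_mono: "linked G T u v \<Longrightarrow> T \<subseteq> T' \<Longrightarrow> linked G T' u v"
  by (erule rtranclp_mono[THEN predicate2D, rotated]) (unfold adj_avoid_def, blast)

lemma linked_sym: "linked G T u v \<Longrightarrow> linked G T v u"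
  by (rule sympD[OF symp_rtranclp]) (auto simp: adj_avoid_def symp_def)

lemma linked_joins: "e \<in> T \<Longrightarrow> joins G e u v \<Longrightarrow> linked G T u v"
  by (rule r_into_rtranclp) (auto simp: adj_avoid_compl)

lemma joins_sym: "joins G e u v \<Longrightarrow> joins G e v u"
  by (auto simp: joins_def)

lemma joins_ends: "e \<in> edges G \<Longrightarrow> joins G e (fst (ends G e)) (snd (ends G e))"
  by (auto simp: joins_def)

lemma linked_ends: "e \<in> T \<Longrightarrow> e \<in> edges G \<Longrightarrow> linked G T (fst (ends G e)) (snd (ends G e))"
  by (rule linked_joins) (auto simp: joins_def)

text \<open>A walk can be shortened so as to use \<open>f\<close> at most once: after a further step
  along \<open>f\<close>, either that step is the last use, with nothing after it, or both uses
  cancel.\<close>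

lemma linked_insert:
  assumes "linked G (insert f T) u v"
  shows "linked G T u v \<or>
    linked G T u (fst (ends G f)) \<and> linked G T (snd (ends G f)) v \<or>
    linked G T u (snd (ends G f)) \<and> linked G T (fst (ends G f)) v"
  using assms
proof (induction rule: rtranclp_induct)
  case base
  then show ?case by simp
next
  case (step y z)
  from step.hyps(2) obtain e where e: "e \<in> insert f T" "joins G e y z"
    by (auto simp: adj_avoid_compl)
  show ?case
  proof (cases "e \<in> T")
    case True
    then have "linked G T y z" using e linked_joins by metis
    then show ?thesis using step.IH by (meson rtranclp_trans)
  next
    case False
    then have "(y = fst (ends G f) \<and> z = snd (ends G f)) \<or> (y = snd (ends G f) \<and> z = fst (ends G f))"
      using e by (auto simp: joins_def)
    then show ?thesis using step.IH by (elim disjE conjE) auto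
  qed
qed

lemma linked_cut:
  assumes "linked G T u v" "T \<inter> cut G A = {}"
  shows "u \<in> A \<longleftrightarrow> v \<in> A"
  using assms(1)
proof (induction rule: rtranclp_induct)
  case (step y z)
  then obtain e where "e \<in> T" "joins G e y z" by (auto simp: adj_avoid_compl)
  then have "y \<in> A \<longleftrightarrow> z \<in> A" using assms(2) by (auto simp: joins_def cut_def)
  then show ?case using step.IH by simp
qed simp

text \<open>Walks are finite. This is the compactness that carries bridges through the chains in
  Zorn's lemma.\<close>

lemma linked_finite_subset:
  assumes "linked G T u v"
  shows "\<exists>F. finite F \<and> F \<subseteq> T \<and> linked G F u v"
  using assms
proof (induction rule: rtranclp_induct)
  case base
  then show ?case by (intro exI[of _ "{}"]) auto
next
  case (step y z)
  obtain F where F: "finite F" "F \<subseteq> T" "linked G F u y" using step.IH by blast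
  obtain e where e: "e \<in> T" "joins G e y z" using step.hyps by (auto simp: adj_avoid_compl)
  have "linked G (insert e F) u y" "linked G (insert e F) y z"
    using linked_mono[OF F(3)] linked_joins[OF _ e(2)] by auto
  then have "linked G (insert e F) u z" by (rule rtranclp_trans)
  then show ?case using e F by (intro exI[of _ "insert e F"]) auto
qed

section \<open>Cuts and bonds\<close>

lemma cut_joins: "joins G f a b \<Longrightarrow> f \<in> cut G A \<longleftrightarrow> (a \<in> A) \<noteq> (b \<in> A)"
  unfolding joins_def cut_def by auto

lemma cut_obtain:
  assumes "f \<in> cut G A"
  obtains a b where "joins G f a b" "a \<in> A" "b \<notin> A"
proof (cases "fst (ends G f) \<in> A")
  case True
  then show thesis using assms that joins_ends[of f G] unfolding cut_def by blast
next
  case False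
  then show thesis using assms that joins_sym[OF joins_ends[of f G]] unfolding cut_def by blast
qed

text \<open>Trimming \<open>A\<close> to \<open>verts G\<close> leaves the cut unchanged, because
  all edges end in \<open>verts G\<close>.\<close>

lemma is_cut_cut: "wf_graph G \<Longrightarrow> is_cut G (cut G A)"
  unfolding is_cut_def
  by (intro exI[of _ "A \<inter> verts G"]) (auto simp: cut_def wf_graph_def)

lemma cut_subset_edges: "cut G A \<subseteq> edges G"
  by (auto simp: cut_def)

lemma bond_subset_edges: "is_bond G D \<Longrightarrow> D \<subseteq> edges G"
  by (auto simp: is_bond_def is_cut_def cut_def)

section \<open>Spanning sets and fundamental bonds\<close>

lemma spanning_linked:
  assumes "spanning G T" "linked G (edges G) u v"
  shows "linked G T u v"
  using assms(2)
proof (induction rule: rtranclp_induct)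
  case (step y z)
  then obtain e where "e \<in> edges G" "ends G e = (y, z) \<or> ends G e = (z, y)"
    by (auto simp: adj_avoid_def)
  then have "linked G T (fst (ends G e)) (snd (ends G e))" "ends G e = (y, z) \<or> ends G e = (z, y)"
    using assms(1) unfolding spanning_def by auto
  then have "linked G T y z" using linked_sym[of G T z y] by auto
  with step.IH show ?case by (rule rtranclp_trans)
qed simp

text \<open>By Zorn's lemma there is a maximal extension whose edges in \<open>S\<close> are all
  bridges. It is spanning, as an edge between two of its components could be added.
  \<open>S = UNIV\<close> yields spanning forests; \<open>S = {e}\<close> protects a single
  edge.\<close>

lemma exists_spanning_extension:
  assumes "T0 \<subseteq> edges G" "\<And>e. e \<in> T0 \<inter> S \<Longrightarrow> bridge G T0 e"
  obtains T where "T0 \<subseteq> T" "T \<subseteq> edges G" "spanning G T" "\<And>e. e \<in> T \<inter> S \<Longrightarrow> bridge G T e"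
proof -
  define P where "P = {T. T0 \<subseteq> T \<and> T \<subseteq> edges G \<and> (\<forall>e\<in>T \<inter> S. bridge G T e)}"
  have "\<exists>M\<in>P. \<forall>X\<in>P. M \<subseteq> X \<longrightarrow> X = M"
  proof (rule subset_Zorn_nonempty)
    show "P \<noteq> {}" using assms unfolding P_def by auto
  next
    fix \<C> assume ne: "\<C> \<noteq> {}" and ch: "subset.chain P \<C>"
    have mem: "X \<in> P" if "X \<in> \<C>" for X using ch that by (auto simp: subset.chain_def)
    have "bridge G (\<Union>\<C>) e" if "e \<in> \<Union>\<C>" "e \<in> S" for e
      unfolding bridge_def
    proof
      assume "linked G (\<Union>\<C> - {e}) (fst (ends G e)) (snd (ends G e))"
      then obtain F where F: "finite F" "F \<subseteq> \<Union>\<C> - {e}" "linked G F (fst (ends G e)) (snd (ends G e))"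
        using linked_finite_subset by meson
      \<comment> \<open>The finitely many edges of a detour around \<open>e\<close>, and
        \<open>e\<close> itself, already lie in one member of the chain.\<close>
      have "finite (insert e F)" "insert e F \<subseteq> \<Union>\<C>" using F that by auto
      then obtain X where X: "X \<in> \<C>" "insert e F \<subseteq> X"
        using finite_subset_Union_chain[OF _ _ ne ch] by blast
      then have "bridge G X e" using mem[OF X(1)] that unfolding P_def by auto
      then show False unfolding bridge_def using linked_mono[OF F(3), of "X - {e}"] X F(2) by auto
    qed
    then show "\<Union>\<C> \<in> P" using ne mem unfolding P_def by blast
  qed
  then obtain T where T: "T \<in> P" and mx: "\<And>X. X \<in> P \<Longrightarrow> T \<subseteq> X \<Longrightarrow> X = T" by blast
  have "linked G T (fst (ends G f)) (snd (ends G f))" if f: "f \<in> edges G" for f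
  proof (rule ccontr)
    assume nl: "\<not> linked G T (fst (ends G f)) (snd (ends G f))"
    then have fT: "f \<notin> T" using f linked_ends by metis
    have "bridge G (insert f T) e" if "e \<in> insert f T" "e \<in> S" for e
    proof (cases "e = f")
      case True
      then show ?thesis using nl fT by (simp add: bridge_def)
    next
      case False
      then have e: "e \<in> T" "bridge G T e" "e \<in> edges G" using that T unfolding P_def by auto
      show ?thesis unfolding bridge_def
      proof
        assume l: "linked G (insert f T - {e}) (fst (ends G e)) (snd (ends G e))"
        have "insert f T - {e} = insert f (T - {e})" using False by auto
        \<comment> \<open>A walk around \<open>e\<close> would have to cross \<open>f\<close>; its
          remaining parts together with \<open>e\<close> would join the ends of \<open>f\<close>
          inside \<open>T\<close>.\<close>
        note l = linked_insert[OF l[unfolded this]]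
        have m: "linked G T x y" if "linked G (T - {e}) x y" for x y
          using linked_mono[OF that] by auto
        have le: "linked G T (fst (ends G e)) (snd (ends G e))" using linked_ends e by metis
        have "linked G T (fst (ends G f)) (snd (ends G f))"
          using l e(2) m le unfolding bridge_def
          by (meson linked_sym rtranclp_trans)
        then show False using nl by simp
      qed
    qed
    then have "insert f T \<in> P" using T f unfolding P_def by auto
    from mx[OF this] fT show False by auto
  qed
  then show thesis using that T unfolding P_def spanning_def by auto
qed

text \<open>The bond is the cut around the component \<open>A\<close> of \<open>T - {e}\<close> at
  one end of \<open>e\<close>. It is minimal because its edges all run between the two components
  that \<open>e\<close> connects, and no cut contained in it can split either of them.\<close>

lemma fundamental_bond:
  assumes wf: "wf_graph G" and T: "T \<subseteq> edges G" "spanning G T" and e: "e \<in> T" "bridge G T e"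
  obtains D where "is_bond G D" "D \<inter> T = {e}"
proof -
  define u v where "u = fst (ends G e)" and "v = snd (ends G e)"
  define A where "A = {x. linked G (T - {e}) u x}"
  have ins: "T = insert e (T - {e})" using e by auto
  have uv: "u \<in> A" "v \<notin> A" using e(2) unfolding A_def bridge_def u_def v_def by auto
  have eD: "e \<in> cut G A" using uv e T unfolding cut_def u_def v_def by auto
  have DT: "f = e" if "f \<in> cut G A" "f \<in> T" for f
  proof (rule ccontr)
    assume "f \<noteq> e"
    then have l: "linked G (T - {e}) (fst (ends G f)) (snd (ends G f))"
      using that T by (intro linked_ends) auto
    then show False using that(1) linked_sym[OF l] unfolding cut_def A_def
      by (auto dest: rtranclp_trans)
  qed
  \<comment> \<open>Inside \<open>T\<close> the only way out of \<open>A\<close> is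
    \<open>e\<close>, so the far end \<open>b\<close> lies in the component of
    \<open>v\<close>.\<close>
  have cross: "linked G (T - {e}) v b" if "a \<in> A" "b \<notin> A" "joins G f a b" for a b f
  proof -
    have "linked G (insert e (T - {e})) a b"
      using spanning_linked[OF T(2) linked_joins[OF _ that(3)]] that(3) ins by (auto simp: joins_def)
    from linked_insert[OF this] show ?thesis
      using that uv unfolding A_def u_def[symmetric] v_def[symmetric]
      by (auto dest: rtranclp_trans)
  qed
  have "cut G A = cut G X" if ne: "cut G X \<noteq> {}" and sub: "cut G X \<subseteq> cut G A" for X
  proof
    have inv: "x \<in> X \<longleftrightarrow> y \<in> X" if "linked G (T - {e}) x y" for x y
      using linked_cut[OF that, of X] DT sub by auto
    have sides: "\<exists>a b. joins G f a b \<and> (a \<in> X \<longleftrightarrow> u \<in> X) \<and> (b \<in> X \<longleftrightarrow> v \<in> X)" if "f \<in> cut G A" for f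
    proof -
      obtain a b where ab: "joins G f a b" "a \<in> A" "b \<notin> A"
        by (rule cut_obtain[OF \<open>f \<in> cut G A\<close>])
      have "u \<in> X \<longleftrightarrow> a \<in> X" using ab(2) inv unfolding A_def by blast
      moreover have "v \<in> X \<longleftrightarrow> b \<in> X" using cross[OF ab(2,3,1)] by (rule inv)
      ultimately show ?thesis using ab(1) by blast
    qed
    \<comment> \<open>One edge of \<open>cut G X\<close> shows that \<open>X\<close> separates
      \<open>u\<close> from \<open>v\<close>; then every edge of \<open>cut G A\<close> crosses
      \<open>X\<close> as well.\<close>
    obtain f where f: "f \<in> cut G X" using ne by auto
    then have uvX: "(u \<in> X) \<noteq> (v \<in> X)" using sides[of f] sub cut_joins[of G f] by (metis subsetD)
    show "cut G A \<subseteq> cut G X"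
    proof
      fix g assume "g \<in> cut G A"
      then obtain a b where "joins G g a b" "a \<in> X \<longleftrightarrow> u \<in> X" "b \<in> X \<longleftrightarrow> v \<in> X"
        using sides by blast
      then show "g \<in> cut G X" using cut_joins uvX by metis
    qed
  qed (rule sub)
  then have "is_bond G (cut G A)"
    using eD is_cut_cut[OF wf, of A] unfolding is_bond_def is_cut_def by blast
  moreover have "cut G A \<inter> T = {e}" using eD DT e(1) by blast
  ultimately show thesis using that by blast
qed

text \<open>Adding \<open>e\<close> to the edges outside \<open>F\<close> makes \<open>e\<close> a
  bridge. In a spanning extension that protects \<open>e\<close>, the fundamental bond of
  \<open>e\<close> avoids all edges outside \<open>F\<close>.\<close>

lemma bond_if_unlinked:
  assumes "wf_graph G" "F \<subseteq> edges G" "e \<in> F"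
    and nl: "\<not> linked G (edges G - F) (fst (ends G e)) (snd (ends G e))"
  shows "\<exists>D. is_bond G D \<and> D \<subseteq> F"
proof -
  define T0 where "T0 = insert e (edges G - F)"
  have "T0 - {e} = edges G - F" using assms by (auto simp: T0_def)
  then have "bridge G T0 e" using nl by (simp add: bridge_def)
  then obtain T where T: "T0 \<subseteq> T" "T \<subseteq> edges G" "spanning G T" "\<And>e'. e' \<in> T \<inter> {e} \<Longrightarrow> bridge G T e'"
    using exists_spanning_extension[of T0 G "{e}"] assms unfolding T0_def by blast
  then obtain D where D: "is_bond G D" "D \<inter> T = {e}"
    using fundamental_bond[OF assms(1) T(2,3), of e] unfolding T0_def by blast
  have "f \<in> F" if "f \<in> D" for f
  proof (rule ccontr)
    assume "f \<notin> F"
    then have "f \<in> D \<inter> T" using that bond_subset_edges[OF D(1)] T(1) unfolding T0_def by auto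
    then show False using D(2) \<open>f \<notin> F\<close> assms(3) by simp
  qed
  then show ?thesis using D(1) by auto
qed

section \<open>Paths and closed paths\<close>

text \<open>The walk is shortened as it grows: on return to an old vertex the path is cut back to
  that vertex, otherwise the new edge is appended.\<close>

lemma linked_imp_path:
  assumes "linked G T u v"
  shows "\<exists>p q n. p 0 = u \<and> p n = v \<and> inj_on p {..n::nat} \<and> inj_on q {..<n} \<and>
    (\<forall>i<n. q i \<in> T \<and> joins G (q i) (p i) (p (Suc i)))"
  using assms
proof (induction rule: rtranclp_induct)
  case base
  show ?case by (intro exI[of _ "\<lambda>_. u"] exI[of _ undefined] exI[of _ 0]) auto
next
  case (step y z)
  then obtain p q n where p: "p 0 = u" "p n = y" "inj_on p {..n::nat}" "inj_on q {..<n}"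
    "\<And>i. i < n \<Longrightarrow> q i \<in> T \<and> joins G (q i) (p i) (p (Suc i))" by metis
  obtain e where e: "e \<in> T" "joins G e y z" using step by (auto simp: adj_avoid_compl)
  show ?case
  proof (cases "z \<in> p ` {..n}")
    case True
    then obtain k where k: "k \<le> n" "z = p k" by auto
    have "inj_on p {..k}" "inj_on q {..<k}"
      using k inj_on_subset[OF p(3)] inj_on_subset[OF p(4)] by auto
    then show ?thesis using p k by (intro exI[of _ p] exI[of _ q] exI[of _ k]) auto
  next
    case False
    \<comment> \<open>A repeated edge would make \<open>z\<close> an old vertex.\<close>
    have "e \<noteq> q i" if "i < n" for i
    proof
      assume "e = q i"
      then have "z = p i \<or> z = p (Suc i)" using e(2) p(5)[OF that] by (auto simp: joins_def)
      then show False using False that by auto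
    qed
    then have 1: "inj_on (q(n := e)) {..<Suc n}" using p(4)
      by (auto simp: lessThan_Suc inj_on_def)
    have 2: "inj_on (p(Suc n := z)) {..Suc n}" using p(3) False
      by (auto simp: atMost_Suc inj_on_def)
    show ?thesis using p e 1 2
      by (intro exI[of _ "p(Suc n := z)"] exI[of _ "q(n := e)"] exI[of _ "Suc n"])
        (auto simp: less_Suc_eq simp del: fun_upd_apply, auto)
  qed
qed

text \<open>The path between the ends of \<open>e\<close> is closed up by \<open>e\<close> as its
  last edge. If \<open>e\<close> is a loop, the path is trivial and the closed path has length
  1.\<close>

lemma linked_imp_closed_path:
  assumes "e \<in> edges G" "linked G (T - {e}) (fst (ends G e)) (snd (ends G e))"
  obtains p q n where "closed_path G p q n" "e \<in> q ` {..<n}" "q ` {..<n} \<subseteq> insert e T"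
proof -
  obtain p q n where p: "p 0 = fst (ends G e)" "p n = snd (ends G e)" "inj_on p {..n::nat}" "inj_on q {..<n}"
    "\<And>i. i < n \<Longrightarrow> q i \<in> T - {e} \<and> joins G (q i) (p i) (p (Suc i))"
    using linked_imp_path[OF assms(2)] by metis
  have 1: "inj_on (q(n := e)) {..<Suc n}" using p(4,5)
    by (fastforce simp: lessThan_Suc inj_on_def)
  have 2: "inj_on (p(Suc n := p 0)) {..<Suc n}" using p(3)
    by (auto simp: inj_on_def lessThan_Suc_atMost)
  have "closed_path G (p(Suc n := p 0)) (q(n := e)) (Suc n)"
    unfolding closed_path_def using 1 2 p assms(1)
    by (auto simp: less_Suc_eq intro: joins_sym joins_ends)
  moreover have "e \<in> (q(n := e)) ` {..<Suc n}" by auto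
  moreover have "(q(n := e)) ` {..<Suc n} \<subseteq> insert e T" using p(5) by (auto simp: less_Suc_eq)
  ultimately show thesis using that by blast
qed

section \<open>Degrees in closed paths and parity of cuts\<close>

lemma deg_in_insert:
  assumes "finite F" "e \<notin> F" "joins G e u v"
  shows "deg_in G (insert e F) x = deg_in G F x + of_bool (u = x) + of_bool (v = x)"
proof -
  have *: "{f \<in> insert e F. P f} = (if P e then insert e {f \<in> F. P f} else {f \<in> F. P f})" for P
    by auto
  have "u = fst (ends G e) \<and> v = snd (ends G e) \<or> v = fst (ends G e) \<and> u = snd (ends G e)"
    using assms(3) by (auto simp: joins_def)
  then show ?thesis using assms(1,2) unfolding deg_in_def * by auto
qed

text \<open>Each end lacks one degree. Putting the corrections on the left avoids subtraction and
  covers the path of length 0, whose ends coincide.\<close>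

lemma deg_in_path:
  assumes "inj_on p {..n::nat}" "inj_on q {..<n}" "\<And>i. i < n \<Longrightarrow> joins G (q i) (p i) (p (Suc i))"
  shows "deg_in G (q ` {..<n}) x + of_bool (p 0 = x) + of_bool (p n = x) = 2 * of_bool (x \<in> p ` {..n})"
  using assms
proof (induction n)
  case 0
  then show ?case by (auto simp: deg_in_def)
next
  case (Suc n)
  have inj: "inj_on p {..n}" "inj_on q {..<n}"
    using inj_on_subset[OF Suc.prems(1)] inj_on_subset[OF Suc.prems(2)] by auto
  note IH = Suc.IH[OF inj Suc.prems(3)]
  have new: "q n \<notin> q ` {..<n}" "p (Suc n) \<notin> p ` {..n}"
    using Suc.prems(1,2) by (auto dest: inj_onD)
  have "deg_in G (q ` {..<Suc n}) x = deg_in G (q ` {..<n}) x + of_bool (p n = x) + of_bool (p (Suc n) = x)"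
    unfolding lessThan_Suc image_insert using new Suc.prems(3)[of n] by (intro deg_in_insert) auto
  then show ?case using IH new(2) by (auto simp: atMost_Suc split: if_splits)
qed

text \<open>Without its last edge a closed path is a path from \<open>p 0\<close> to
  \<open>p m\<close>; the last edge supplies exactly the two missing degrees.\<close>

lemma finite_cycle_closed_path:
  assumes "closed_path G p q n"
  shows "is_finite_cycle G (q ` {..<n})"
proof -
  obtain m where n: "n = Suc m" using assms unfolding closed_path_def by (cases n) auto
  have c: "p n = p 0" "inj_on p {..<n}" "inj_on q {..<n}" "\<And>i. i < n \<Longrightarrow> joins G (q i) (p i) (p (Suc i))"
    using assms unfolding closed_path_def by auto
  have pm: "inj_on p {..m}" "inj_on q {..<m}"
    using c(2,3) unfolding n by (auto simp: inj_on_def)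
  have deg: "deg_in G (q ` {..<n}) x = 2 * of_bool (x \<in> p ` {..m})" for x
  proof -
    have new: "q m \<notin> q ` {..<m}" using c(3) n by (auto dest: inj_onD)
    have "deg_in G (q ` {..<n}) x = deg_in G (q ` {..<m}) x + of_bool (p m = x) + of_bool (p n = x)"
      unfolding n lessThan_Suc image_insert using new c(4)[of m] n by (intro deg_in_insert) auto
    also have "\<dots> = 2 * of_bool (x \<in> p ` {..m})"
      using deg_in_path[OF pm c(4), of x] n c(1) by simp
    finally show ?thesis .
  qed
  have sub: "q ` {..<n} \<subseteq> edges G" using c(4) by (auto simp: joins_def)
  then have eq: "adj_avoid G (edges G - q ` {..<n}) = adj_avoid G (- q ` {..<n})"
    by (intro ext) (auto simp: adj_avoid_def)
  have l: "linked G (q ` {..<n}) (p 0) (p i)" if "i \<le> n" for i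
    using that
  proof (induction i)
    case (Suc i)
    then have "linked G (q ` {..<n}) (p i) (p (Suc i))" by (intro linked_joins[OF _ c(4)]) auto
    then show ?case using Suc by (meson Suc_leD rtranclp_trans)
  qed simp
  have "linked G (q ` {..<n}) u v" if "deg_in G (q ` {..<n}) u > 0 \<and> deg_in G (q ` {..<n}) v > 0" for u v
  proof -
    have "u \<in> p ` {..m}" "v \<in> p ` {..m}" using that deg by (metis of_bool_eq(1) mult_0_right less_irrefl)+
    then obtain i j where "u = p i" "i \<le> m" "v = p j" "j \<le> m" by auto
    then show ?thesis using rtranclp_trans[OF linked_sym[OF l] l, of i j] n by simp
  qed
  then show ?thesis unfolding is_finite_cycle_def eq using deg sub n by auto
qed

text \<open>Handshake count on one side: summing degrees over \<open>A\<close> counts the edges of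
  \<open>C\<close> inside \<open>A\<close> twice and those in the cut once.\<close>

lemma even_cut:
  assumes "finite C" "\<And>v. v \<in> A \<Longrightarrow> even (deg_in G C v)" "C \<subseteq> edges G"
  shows "even (card (C \<inter> cut G A))"
proof -
  \<comment> \<open>\<open>A\<close> may be infinite, so the sum runs over those vertices of
    \<open>A\<close> that meet \<open>C\<close>.\<close>
  define W where "W = A \<inter> (\<lambda>e. fst (ends G e)) ` C \<union> A \<inter> (\<lambda>e. snd (ends G e)) ` C"
  have W: "finite W" "W \<subseteq> A" using assms(1) by (auto simp: W_def)
  define X Y where "X = {e \<in> C. fst (ends G e) \<in> A}" and "Y = {e \<in> C. snd (ends G e) \<in> A}"
  have "(\<Sum>v\<in>W. deg_in G C v) = card X + card Y"
  proof -
    have "(\<Sum>v\<in>W. card {e \<in> C. h e = v}) = card {e \<in> C. h e \<in> W}" for h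
    proof -
      have "card (\<Union>v\<in>W. {e \<in> C. h e = v}) = (\<Sum>v\<in>W. card {e \<in> C. h e = v})"
        using W assms(1) by (intro card_UN_disjoint) auto
      moreover have "(\<Union>v\<in>W. {e \<in> C. h e = v}) = {e \<in> C. h e \<in> W}" by auto
      ultimately show ?thesis by simp
    qed
    moreover have "{e \<in> C. fst (ends G e) \<in> W} = X" "{e \<in> C. snd (ends G e) \<in> W} = Y"
      by (auto simp: W_def X_def Y_def)
    ultimately show ?thesis by (simp add: deg_in_def sum.distrib)
  qed
  moreover have "even (\<Sum>v\<in>W. deg_in G C v)" using W assms(2) by (intro dvd_sum) auto
  ultimately have ev: "even (card X + card Y)" by simp
  have fin: "finite X" "finite Y" using assms(1) by (auto simp: X_def Y_def)
  have "C \<inter> cut G A = (X - Y) \<union> (Y - X)" using assms(3) by (auto simp: X_def Y_def cut_def)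
  then have "card (C \<inter> cut G A) = card (X - Y) + card (Y - X)"
    using fin by (simp only:) (rule card_Un_disjoint; auto)
  moreover have "card X = card (X - Y) + card (X \<inter> Y)" "card Y = card (Y - X) + card (X \<inter> Y)"
    using fin by (metis card_Int_Diff add.commute Int_commute)+
  ultimately show ?thesis using ev by presburger
qed

text \<open>The parity count rests on finiteness of the cycle alone, so it also covers infinite
  bonds.\<close>

lemma finite_cycle_cut:
  assumes "wf_graph G" "is_finite_cycle G C" "is_cut G D"
  shows "C \<inter> D \<noteq> {e}"
proof
  assume e: "C \<inter> D = {e}"
  obtain A where A: "A \<subseteq> verts G" "D = cut G A" using assms(3) by (auto simp: is_cut_def)
  have "even (card (C \<inter> cut G A))"
    using assms(2) A by (intro even_cut) (fastforce simp: is_finite_cycle_def)+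
  then show False using e A by simp
qed

section \<open>The dual of the bond matroid\<close>

lemma acyclic_imp_bridge:
  assumes "I \<in> M_FC G" "e \<in> I"
  shows "bridge G I e"
  unfolding bridge_def
proof
  assume l: "linked G (I - {e}) (fst (ends G e)) (snd (ends G e))"
  have I: "I \<subseteq> edges G" "\<And>C. is_finite_cycle G C \<Longrightarrow> \<not> C \<subseteq> I"
    using assms unfolding M_FC_def indep_of_circuits_def by auto
  obtain p q n where "closed_path G p q n" "q ` {..<n} \<subseteq> insert e I"
    using linked_imp_closed_path[OF _ l] assms I by blast
  then show False using finite_cycle_closed_path I(2) assms(2) by (metis insert_absorb)
qed

lemma exists_spanning_forest:
  assumes "I \<in> M_FC G"
  obtains T where "I \<subseteq> T" "T \<subseteq> edges G" "spanning G T" "\<And>e. e \<in> T \<Longrightarrow> bridge G T e"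
proof -
  have "I \<subseteq> edges G" using assms by (simp add: M_FC_def indep_of_circuits_def)
  then show thesis
    using exists_spanning_extension[of I G UNIV] acyclic_imp_bridge[OF assms] that by auto
qed

text \<open>If a cycle \<open>C\<close> misses a base, adding an edge of \<open>C\<close> to the
  base creates a bond meeting \<open>C\<close> in that edge only. Conversely, the complement of a
  spanning forest is a base: spanning sets meet every bond, and adding a forest edge completes its
  fundamental bond.\<close>

lemma dual_M_B:
  assumes wf: "wf_graph G"
  shows "dual_indep (edges G) (M_B G) = M_FC G"
proof (intro subset_antisym subsetI)
  fix I assume "I \<in> dual_indep (edges G) (M_B G)"
  then obtain B where B: "is_base (M_B G) B" "I \<subseteq> edges G - B" unfolding dual_indep_def by auto
  have "\<not> C \<subseteq> I" if C: "is_finite_cycle G C" for C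
  proof
    assume CI: "C \<subseteq> I"
    obtain e where e: "e \<in> C" using C by (auto simp: is_finite_cycle_def)
    have BM: "B \<in> M_B G" using B by (simp add: is_base_def)
    have "insert e B \<notin> M_B G"
      using B CI e unfolding is_base_def by blast
    then obtain D where D: "is_bond G D" "D \<subseteq> insert e B"
      using BM B CI e unfolding M_B_def indep_of_circuits_def by auto
    then have "e \<in> D" using BM unfolding M_B_def indep_of_circuits_def by auto
    then have "C \<inter> D = {e}" using D e CI B by auto
    then show False using finite_cycle_cut[OF wf C] D by (auto simp: is_bond_def)
  qed
  then show "I \<in> M_FC G" using B unfolding M_FC_def indep_of_circuits_def by auto
next
  fix I assume I: "I \<in> M_FC G"
  obtain T where T: "I \<subseteq> T" "T \<subseteq> edges G" "spanning G T" "\<And>e. e \<in> T \<Longrightarrow> bridge G T e"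
    using exists_spanning_forest[OF I] by blast
  have "\<not> D \<subseteq> edges G - T" if D: "is_bond G D" for D
  proof
    assume DT: "D \<subseteq> edges G - T"
    obtain A where A: "D = cut G A" using D by (auto simp: is_bond_def is_cut_def)
    obtain f where f: "f \<in> D" using D by (auto simp: is_bond_def)
    have "linked G T (fst (ends G f)) (snd (ends G f))"
      using f DT T(3) by (auto simp: spanning_def)
    then have "fst (ends G f) \<in> A \<longleftrightarrow> snd (ends G f) \<in> A"
      using DT A by (intro linked_cut) auto
    then show False using f A by (simp add: cut_def)
  qed
  then have ind: "edges G - T \<in> M_B G" unfolding M_B_def indep_of_circuits_def by auto
  have "J = edges G - T" if J: "J \<in> M_B G" "edges G - T \<subseteq> J" for J
  proof (rule ccontr)
    assume "J \<noteq> edges G - T"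
    then obtain e where e: "e \<in> J" "e \<in> T"
      using J unfolding M_B_def indep_of_circuits_def by auto
    obtain D where D: "is_bond G D" "D \<inter> T = {e}" using fundamental_bond[OF wf T(2,3) e(2) T(4)[OF e(2)]] .
    then have "D \<subseteq> J" using bond_subset_edges[of G D] J(2) e by auto
    then show False using J(1) D unfolding M_B_def indep_of_circuits_def by auto
  qed
  then have "is_base (M_B G) (edges G - T)" unfolding is_base_def using ind by auto
  moreover have "I \<subseteq> edges G - (edges G - T)" "I \<subseteq> edges G" using T by auto
  ultimately show "I \<in> dual_indep (edges G) (M_B G)" unfolding dual_indep_def by blast
qed

section \<open>The topology of graphs with edge-ends\<close>

text \<open>For finite sets \<open>Z\<close> of inner points, the sets \<open>hat G C\<close> with
  \<open>C\<close> in \<open>pieces G Z\<close> are the basic open sets of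
  \<open>absG G\<close>.\<close>

abbreviation pieces :: "('v, 'e) graph \<Rightarrow> ('v, 'e) pt set \<Rightarrow> ('v, 'e) pt set set" where
  "pieces G Z \<equiv> connected_components_of (subtopology (XH_top G) (XH G - Z))"

section \<open>The weak topology on \<open>XH G\<close>\<close>

lemma openin_XH_top: "openin (XH_top G) U \<longleftrightarrow> XH_open G U"
  unfolding XH_top_def by (simp add: topology_inverse'[OF istopology_XH_open])

lemma edge_map_in_XH: "wf_graph G \<Longrightarrow> e \<in> edges G \<Longrightarrow> t \<in> {0..1} \<Longrightarrow> edge_map G e t \<in> XH G"
  by (auto simp: edge_map_def XH_def inner_points_def wf_graph_def)

lemma topspace_XH_top:
  assumes "wf_graph G"
  shows "topspace (XH_top G) = XH G"
proof
  show "topspace (XH_top G) \<subseteq> XH G"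
    using openin_topspace[of "XH_top G"] unfolding openin_XH_top XH_open_def by blast
  have "{t \<in> {0..1}. edge_map G e t \<in> XH G} = {0..1}" if "e \<in> edges G" for e
    using edge_map_in_XH[OF assms that] by blast
  then have "XH_open G (XH G)" unfolding XH_open_def by simp
  then show "XH G \<subseteq> topspace (XH_top G)" using openin_subset openin_XH_top by blast
qed

lemma continuous_map_edge_map:
  assumes "wf_graph G" "e \<in> edges G"
  shows "continuous_map (top_of_set {0..1}) (XH_top G) (edge_map G e)"
  using assms edge_map_in_XH[OF assms]
  by (auto simp: continuous_map_def topspace_XH_top openin_XH_top XH_open_def)

lemma openin_XH_diff:
  assumes "wf_graph G" "finite Z" "Z \<subseteq> inner_points G"
  shows "openin (XH_top G) (XH G - Z)"
  unfolding openin_XH_top XH_open_def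
proof (intro conjI ballI)
  fix e assume e: "e \<in> edges G"
  define K where "K = PE e -` Z"
  have "finite K" unfolding K_def using assms(2) by (intro finite_vimageI) (auto simp: inj_def)
  then have "open (- K)" by (simp add: finite_imp_closed open_Compl)
  moreover have "{t \<in> {0..1}. edge_map G e t \<in> XH G - Z} = {0..1} \<inter> (- K)"
  proof -
    have "edge_map G e t \<in> Z \<longleftrightarrow> t \<in> K" if "t \<in> {0..1}" for t
      using assms(3) that by (auto simp: edge_map_def K_def inner_points_def)
    then show ?thesis using edge_map_in_XH[OF assms(1) e] by blast
  qed
  ultimately show "openin (top_of_set {0..1}) {t \<in> {0..1}. edge_map G e t \<in> XH G - Z}"
    by (metis openin_open_Int)
qed auto

text \<open>Local connectedness, tested edge by edge: a short interval of an edge around a point of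
  \<open>C\<close> has a connected image inside \<open>W\<close>, which therefore stays in the
  component \<open>C\<close>.\<close>

lemma XH_locally_connected:
  assumes wf: "wf_graph G" and W: "openin (XH_top G) W"
    and C: "C \<in> connected_components_of (subtopology (XH_top G) W)"
  shows "openin (XH_top G) C"
  unfolding openin_XH_top XH_open_def
proof (intro conjI ballI)
  have CW: "C \<subseteq> W" using connected_components_of_subset[OF C] by auto
  have WX: "W \<subseteq> XH G" using W by (simp add: openin_XH_top XH_open_def)
  show "C \<subseteq> XH G" using CW WX by auto
  fix e assume e: "e \<in> edges G"
  show "openin (top_of_set {0..1}) {t \<in> {0..1}. edge_map G e t \<in> C}"
    unfolding openin_euclidean_subtopology_iff
  proof (intro conjI ballI)
    fix t assume t: "t \<in> {t \<in> {0..1}. edge_map G e t \<in> C}"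
    have "openin (top_of_set {0..1}) {t \<in> {0..1}. edge_map G e t \<in> W}"
      using W e by (auto simp: openin_XH_top XH_open_def)
    then obtain \<epsilon> where eps: "\<epsilon> > 0" "\<And>s. s \<in> {0..1} \<Longrightarrow> dist s t < \<epsilon> \<Longrightarrow> edge_map G e s \<in> W"
      using t CW unfolding openin_euclidean_subtopology_iff by blast
    define J where "J = {0..1} \<inter> ball t \<epsilon>"
    have "connected J" unfolding J_def by (intro convex_connected convex_Int) auto
    then have "connectedin (top_of_set {0..1}) J" by (simp add: connectedin_subtopology J_def)
    then have "connectedin (XH_top G) (edge_map G e ` J)"
      by (rule connectedin_continuous_map_image[OF continuous_map_edge_map[OF wf e]])
    moreover have "edge_map G e ` J \<subseteq> W" using eps(2) by (auto simp: J_def dist_commute)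
    ultimately have "connectedin (subtopology (XH_top G) W) (edge_map G e ` J)"
      by (simp add: connectedin_subtopology)
    moreover have "edge_map G e t \<in> C \<inter> edge_map G e ` J" using t eps(1) by (auto simp: J_def)
    ultimately have "edge_map G e ` J \<subseteq> C"
      using connected_components_of_maximal[OF C] by (auto simp: disjnt_def)
    then show "\<exists>\<epsilon>>0. \<forall>s\<in>{0..1}. dist s t < \<epsilon> \<longrightarrow> s \<in> {t \<in> {0..1}. edge_map G e t \<in> C}"
      using eps(1) by (intro exI[of _ \<epsilon>]) (auto simp: J_def dist_commute)
  qed auto
qed

section \<open>Pieces and basic open sets\<close>

lemma openin_hat:
  "finite Z \<Longrightarrow> Z \<subseteq> inner_points G \<Longrightarrow> C \<in> pieces G Z \<Longrightarrow> openin (absG G) (hat G C)"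
  unfolding absG_def basic_opens_def by (rule topology_generated_by_Basis) blast

lemma piece_subset: "C \<in> pieces G Z \<Longrightarrow> C \<subseteq> XH G - Z"
  by (drule connected_components_of_subset) auto

lemma piece_obtain:
  assumes "wf_graph G" "x \<in> XH G" "x \<notin> Z"
  obtains C where "C \<in> pieces G Z" "x \<in> C"
proof -
  define X where "X = subtopology (XH_top G) (XH G - Z)"
  have "x \<in> topspace X" using assms by (simp add: X_def topspace_XH_top)
  then have "connected_component_of_set X x \<in> connected_components_of X" "x \<in> connected_component_of_set X x"
    by (simp_all add: connected_component_in_connected_components_of connected_component_of_refl)
  then show thesis unfolding X_def by (rule that)
qed

lemma piece_maximal:
  assumes "C \<in> pieces G Z" "connectedin (XH_top G) K" "K \<subseteq> XH G - Z" "x \<in> C" "x \<in> K"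
  shows "K \<subseteq> C"
  using assms connected_components_of_maximal[OF assms(1), of K]
  by (auto simp: connectedin_subtopology disjnt_def)

lemma piece_split:
  assumes "C \<in> pieces G Z" "openin (XH_top G) U" "openin (XH_top G) V" "U \<inter> V = {}" "XH G - Z \<subseteq> U \<union> V"
  shows "C \<subseteq> U \<or> C \<subseteq> V"
proof -
  have "connectedin (XH_top G) C" "C \<subseteq> U \<union> V"
    using connectedin_connected_components_of[OF assms(1)] piece_subset[OF assms(1)] assms(5)
    by (auto simp: connectedin_subtopology)
  then show ?thesis using connectedinD[of "XH_top G" C U V] assms by blast
qed

lemma hat_Int_XH: "hat G C \<inter> XH G = C \<inter> XH G"
  by (auto simp: hat_def XH_def inner_points_def)

lemma subset_hat: "C \<subseteq> hat G C"
  by (auto simp: hat_def)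

lemma topspace_absG: "topspace (absG G) = \<Union>(basic_opens G)"
  by (simp add: absG_def)

lemma XH_subset_absG:
  assumes "wf_graph G"
  shows "XH G \<subseteq> topspace (absG G)"
proof
  fix x assume "x \<in> XH G"
  then obtain C where "C \<in> pieces G {}" "x \<in> C" using piece_obtain[OF assms, of x "{}"] by blast
  then show "x \<in> topspace (absG G)"
    using openin_subset[OF openin_hat[of "{}" G C]] subset_hat by blast
qed

lemma absG_subset: "topspace (absG G) \<subseteq> XH G \<union> PEnd ` edge_ends G"
  unfolding topspace_absG basic_opens_def hat_def using piece_subset by blast

text \<open>A basic open set meets \<open>XH G\<close> in its piece, which is open by local
  connectedness. The inverse can fail to be continuous at a vertex of infinite degree, where
  \<open>absG G\<close> has fewer neighbourhoods.\<close>

lemma continuous_map_XH_absG: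
  assumes wf: "wf_graph G"
  shows "continuous_map (XH_top G) (absG G) (\<lambda>x. x)"
  unfolding absG_def continuous_on_generated_topo_iff
proof (intro conjI allI impI)
  fix U assume "U \<in> basic_opens G"
  then obtain C Z where C: "U = hat G C" "finite Z" "Z \<subseteq> inner_points G" "C \<in> pieces G Z"
    unfolding basic_opens_def by blast
  have "(\<lambda>x. x) -` U \<inter> topspace (XH_top G) = C"
    using hat_Int_XH[of G C] piece_subset[OF C(4)] C(1) by (auto simp: topspace_XH_top[OF wf])
  then show "openin (XH_top G) ((\<lambda>x. x) -` U \<inter> topspace (XH_top G))"
    using XH_locally_connected[OF wf openin_XH_diff[OF wf C(2,3)] C(4)] by simp
next
  show "(\<lambda>x. x) ` topspace (XH_top G) \<subseteq> \<Union>(basic_opens G)"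
    using XH_subset_absG[OF wf] by (simp add: topspace_XH_top[OF wf] topspace_absG)
qed

section \<open>Splitting the space along a cut\<close>

text \<open>The part of the space on the \<open>A\<close>-side once every edge \<open>e\<close> leaving \<open>A\<close> is cut at its point
  \<open>\<tau> e\<close>; an edge with both ends in \<open>A\<close> is contained in it entirely.\<close>
definition side :: "('v, 'e) graph \<Rightarrow> ('e \<Rightarrow> real) \<Rightarrow> 'v set \<Rightarrow> ('v, 'e) pt set" where
  "side G \<tau> A = PV ` (verts G \<inter> A) \<union> {PE e t | e t. e \<in> edges G \<and> 0 < t \<and> t < 1 \<and>
     (if t < \<tau> e then fst (ends G e) \<in> A
      else if t > \<tau> e then snd (ends G e) \<in> A
      else fst (ends G e) \<in> A \<and> snd (ends G e) \<in> A)}"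

text \<open>As \<open>\<tau> e\<close> is an inner point, each end of \<open>e\<close> falls on its
  own side of it; the preimage in \<open>e\<close> is everything, nothing, or one of the two parts
  cut off at \<open>\<tau> e\<close>.\<close>

lemma openin_side:
  assumes wf: "wf_graph G" and \<tau>: "\<And>e. 0 < \<tau> e \<and> \<tau> e < 1"
  shows "openin (XH_top G) (side G \<tau> A)"
  unfolding openin_XH_top XH_open_def
proof (intro conjI ballI)
  show "side G \<tau> A \<subseteq> XH G" by (auto simp: side_def XH_def inner_points_def)
  fix e assume e: "e \<in> edges G"
  define u v where "u = fst (ends G e)" and "v = snd (ends G e)"
  have uv: "u \<in> verts G" "v \<in> verts G" using wf e by (auto simp: u_def v_def wf_graph_def)
  have iff: "edge_map G e t \<in> side G \<tau> A \<longleftrightarrow>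
      (if t < \<tau> e then u \<in> A else if t > \<tau> e then v \<in> A else u \<in> A \<and> v \<in> A)"
    if "t \<in> {0..1}" for t
    using that \<tau>[of e] e uv by (auto simp: edge_map_def side_def u_def[symmetric] v_def[symmetric])
  have "{t \<in> {0..1}. edge_map G e t \<in> side G \<tau> A} = {0..1} \<inter>
     (if u \<in> A then if v \<in> A then UNIV else {..<\<tau> e} else if v \<in> A then {\<tau> e<..} else {})"
    using iff by (auto split: if_splits)
  then show "openin (top_of_set {0..1}) {t \<in> {0..1}. edge_map G e t \<in> side G \<tau> A}"
    by (simp add: openin_open_Int del: Int_UNIV_right split: if_splits)
qed

lemma side_disjoint: "side G \<tau> A \<inter> side G \<tau> (- A) = {}"
  by (auto simp: side_def split: if_splits)

lemma side_cover: "XH G - (\<lambda>e. PE e (\<tau> e)) ` cut G A \<subseteq> side G \<tau> A \<union> side G \<tau> (- A)"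
proof
  fix x assume x: "x \<in> XH G - (\<lambda>e. PE e (\<tau> e)) ` cut G A"
  show "x \<in> side G \<tau> A \<union> side G \<tau> (- A)"
  proof (cases x)
    case (PE e t)
    then have "e \<in> edges G" "0 < t" "t < 1" "t = \<tau> e \<Longrightarrow> e \<notin> cut G A"
      using x by (auto simp: XH_def inner_points_def)
    then show ?thesis unfolding PE side_def cut_def
      by (cases t "\<tau> e" rule: linorder_cases) auto
  qed (use x in \<open>auto simp: side_def XH_def inner_points_def\<close>)
qed

lemma cut_points:
  assumes "\<And>e. 0 < \<tau> e \<and> \<tau> e < 1"
  shows "(\<lambda>e. PE e (\<tau> e)) ` cut G A \<subseteq> inner_points G"
  using assms by (auto simp: inner_points_def cut_def)

section \<open>Separation of points of \<open>XH G\<close>\<close>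

text \<open>Each piece lies within \<open>U\<close> or within \<open>V\<close>, so \<open>x\<close>
  and \<open>y\<close> are in different pieces, whose hats separate them. Disjointness is claimed on
  \<open>XH G\<close> only, where a hat agrees with its piece.\<close>

lemma absG_separates:
  assumes wf: "wf_graph G" and Z: "finite Z" "Z \<subseteq> inner_points G"
    and U: "openin (XH_top G) U" and V: "openin (XH_top G) V"
    and UV: "U \<inter> V = {}" "XH G - Z \<subseteq> U \<union> V" and x: "x \<in> U" "x \<notin> Z" and y: "y \<in> V" "y \<notin> Z"
  shows "\<exists>P Q. openin (absG G) P \<and> openin (absG G) Q \<and> x \<in> P \<and> y \<in> Q \<and> P \<inter> Q \<inter> XH G = {}"
proof -
  have xy: "x \<in> XH G" "y \<in> XH G" using U V x y by (auto simp: openin_XH_top XH_open_def)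
  obtain C where C: "C \<in> pieces G Z" "x \<in> C" using piece_obtain[OF wf xy(1) x(2)] by blast
  obtain D where D: "D \<in> pieces G Z" "y \<in> D" using piece_obtain[OF wf xy(2) y(2)] by blast
  have "C \<noteq> D" using piece_split[OF C(1) U V UV] C D x y UV(1) by blast
  then have "C \<inter> D = {}"
    using connected_components_of_disjoint[OF C(1) D(1)] by (simp add: disjnt_def)
  then have "hat G C \<inter> hat G D \<inter> XH G = {}" using hat_Int_XH[of G C] hat_Int_XH[of G D] by blast
  then show ?thesis using openin_hat[OF Z C(1)] openin_hat[OF Z D(1)] C(2) D(2) subset_hat by blast
qed

text \<open>Two inner points of \<open>e\<close>, one on either side of \<open>t\<close>, cut off a
  segment around the given point that misses \<open>y\<close>.\<close>

lemma separate_inner_point: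
  assumes wf: "wf_graph G" and x: "PE e t \<in> XH G" and y: "y \<in> XH G" "y \<noteq> PE e t"
  shows "\<exists>P Q. openin (absG G) P \<and> openin (absG G) Q \<and> PE e t \<in> P \<and> y \<in> Q \<and> P \<inter> Q \<inter> XH G = {}"
proof -
  have e: "e \<in> edges G" and t: "0 < t" "t < 1" using x by (auto simp: XH_def inner_points_def)
  \<comment> \<open>If \<open>y\<close> is an inner point of \<open>e\<close>, this is its distance
    to \<open>t\<close>; otherwise any positive value serves.\<close>
  define \<delta> where "\<delta> = (case y of PE f s \<Rightarrow> if f = e then \<bar>s - t\<bar> else 1 | _ \<Rightarrow> 1)"
  have "\<delta> > 0" using y(2) by (auto simp: \<delta>_def split: pt.splits)
  define \<epsilon> where "\<epsilon> = min \<delta> (min t (1 - t)) / 2"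
  have eps: "0 < \<epsilon>" "\<epsilon> < \<delta>" "\<epsilon> < t" "\<epsilon> < 1 - t" using t \<open>\<delta> > 0\<close> by (auto simp: \<epsilon>_def)
  define a b where "a = t - \<epsilon>" and "b = t + \<epsilon>"
  have ab: "0 < a" "a < t" "t < b" "b < 1" using eps by (auto simp: a_def b_def)
  have ny: "y \<notin> PE e ` {a..b}" using eps(2) by (auto simp: \<delta>_def a_def b_def)
  define Z where "Z = {PE e a, PE e b :: ('a, 'b) pt}"
  define U where "U = (PE e ` {a<..<b} :: ('a, 'b) pt set)"
  define V where "V = XH G - PE e ` {a..b}"
  have Z: "finite Z" "Z \<subseteq> inner_points G" using e ab by (auto simp: Z_def inner_points_def)
  have UX: "PE e ` {a..b} \<subseteq> XH G" using e ab by (auto simp: XH_def inner_points_def)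
  have pre: "edge_map G f s \<in> PE e ` I \<longleftrightarrow> f = e \<and> s \<in> I" if "I \<subseteq> {a..b}" for f s I
    using that ab by (auto simp: edge_map_def image_iff)
  have U: "openin (XH_top G) U" unfolding openin_XH_top XH_open_def
  proof (intro conjI ballI)
    show "U \<subseteq> XH G" using UX by (auto simp: U_def)
    fix f assume "f \<in> edges G"
    have "{s \<in> {0..1}. edge_map G f s \<in> U} = {0..1} \<inter> (if f = e then {a<..<b} else {})"
      unfolding U_def by (subst pre) auto
    then show "openin (top_of_set {0..1}) {s \<in> {0..1}. edge_map G f s \<in> U}"
      by (simp add: openin_open_Int)
  qed
  have V: "openin (XH_top G) V" unfolding openin_XH_top XH_open_def
  proof (intro conjI ballI)
    show "V \<subseteq> XH G" by (auto simp: V_def)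
    fix f assume f: "f \<in> edges G"
    have "{s \<in> {0..1}. edge_map G f s \<in> V} = {0..1} \<inter> (if f = e then - {a..b} else UNIV)"
      using edge_map_in_XH[OF wf f] pre[of "{a..b}" f] unfolding V_def by auto
    then show "openin (top_of_set {0..1}) {s \<in> {0..1}. edge_map G f s \<in> V}"
      by (simp add: openin_open_Int open_Compl del: Int_UNIV_right)
  qed
  have "U \<inter> V = {}" by (auto simp: U_def V_def)
  moreover have "XH G - Z \<subseteq> U \<union> V" by (auto simp: U_def V_def Z_def image_iff)
  moreover have "PE e t \<in> U" "PE e t \<notin> Z" using ab by (auto simp: U_def Z_def)
  moreover have "y \<in> V" "y \<notin> Z" using y ny ab by (auto simp: V_def Z_def)
  ultimately show ?thesis by (intro absG_separates[OF wf Z U V])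
qed

text \<open>All edges leaving the component of \<open>u\<close> in \<open>G - F\<close> belong to
  the finite set \<open>F\<close>; cutting them at their midpoints leaves two open sides.\<close>

lemma separate_vertices:
  assumes wf: "wf_graph G" and fs: "finitely_separable G" and uv: "u \<in> verts G" "v \<in> verts G" "u \<noteq> v"
  shows "\<exists>P Q. openin (absG G) P \<and> openin (absG G) Q \<and> PV u \<in> P \<and> PV v \<in> Q \<and> P \<inter> Q \<inter> XH G = {}"
proof -
  obtain F where F: "finite F" "\<not> (adj_avoid G F)\<^sup>*\<^sup>* u v"
    using fs uv unfolding finitely_separable_def by blast
  define A where "A = {w. (adj_avoid G F)\<^sup>*\<^sup>* u w}"
  have "cut G A \<subseteq> F"
  proof
    fix f assume "f \<in> cut G A"
    then obtain a b where ab: "joins G f a b" "a \<in> A" "b \<notin> A" by (rule cut_obtain)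
    show "f \<in> F"
    proof (rule ccontr)
      assume "f \<notin> F"
      then have "adj_avoid G F a b" using ab(1) by (auto simp: adj_avoid_def joins_def)
      then show False using ab(2,3) unfolding A_def by (simp add: rtranclp.rtrancl_into_rtrancl)
    qed
  qed
  then have fin: "finite (cut G A)" using F(1) finite_subset by blast
  define \<tau> :: "'b \<Rightarrow> real" where "\<tau> = (\<lambda>_. 1/2)"
  have \<tau>: "0 < \<tau> e \<and> \<tau> e < 1" for e by (simp add: \<tau>_def)
  show ?thesis
  proof (rule absG_separates[OF wf _ cut_points[OF \<tau>] openin_side[OF wf \<tau>] openin_side[OF wf \<tau>] side_disjoint side_cover])
    show "finite ((\<lambda>e. PE e (\<tau> e)) ` cut G A)" using fin by simp
    show "PV u \<in> side G \<tau> A" "PV v \<in> side G \<tau> (- A)" using uv F(2) by (auto simp: side_def A_def)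
  qed auto
qed

text \<open>Prepares the passage from a continuous bijection to a homeomorphism for finite cycles,
  which contain no edge-ends. Finite separability handles pairs of vertices.\<close>

lemma Hausdorff_absG_XH:
  assumes wf: "wf_graph G" and fs: "finitely_separable G" and S: "S \<subseteq> XH G"
  shows "Hausdorff_space (subtopology (absG G) S)"
  unfolding Hausdorff_space_def
proof (intro allI impI)
  fix x y assume "x \<in> topspace (subtopology (absG G) S) \<and> y \<in> topspace (subtopology (absG G) S) \<and> x \<noteq> y"
  then have xy: "x \<in> S" "y \<in> S" "x \<in> XH G" "y \<in> XH G" "x \<noteq> y" using S by auto
  have "\<exists>P Q. openin (absG G) P \<and> openin (absG G) Q \<and> x \<in> P \<and> y \<in> Q \<and> P \<inter> Q \<inter> XH G = {}"
  proof (cases "\<exists>u v. x = PV u \<and> y = PV v")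
    case True
    then show ?thesis using separate_vertices[OF wf fs] xy by (auto simp: XH_def inner_points_def)
  next
    case False
    then consider e t where "x = PE e t" | e t where "y = PE e t"
      using xy(3,4) by (auto simp: XH_def inner_points_def)
    then show ?thesis
    proof cases
      case 1
      then show ?thesis using separate_inner_point[OF wf] xy by metis
    next
      case 2
      then obtain P Q where "openin (absG G) P" "openin (absG G) Q" "y \<in> P" "x \<in> Q" "P \<inter> Q \<inter> XH G = {}"
        using separate_inner_point[OF wf, of e t x] xy by metis
      then show ?thesis by (metis Int_commute)
    qed
  qed
  then obtain P Q where "openin (absG G) P" "openin (absG G) Q" "x \<in> P" "y \<in> Q" "P \<inter> Q \<inter> XH G = {}"
    by blast
  then show "\<exists>U V. openin (subtopology (absG G) S) U \<and> openin (subtopology (absG G) S) V \<and> x \<in> U \<and> y \<in> V \<and> disjnt U V"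
    using xy S by (intro exI[of _ "P \<inter> S"] exI[of _ "Q \<inter> S"]) (auto simp: openin_subtopology disjnt_def)
qed

section \<open>Circles and finite cuts\<close>

text \<open>The vertices of a ray are distinct, hence so are its edges, and only finitely many of
  them lie in \<open>F\<close>.\<close>

lemma ray_avoids_finite:
  assumes "is_ray G \<rho>" "finite F"
  obtains n where "\<And>k. k \<ge> n \<Longrightarrow> snd \<rho> k \<notin> F"
proof -
  have inj: "inj (fst \<rho>)" and ends: "\<And>i. ends G (snd \<rho> i) = (fst \<rho> i, fst \<rho> (Suc i)) \<or>
      ends G (snd \<rho> i) = (fst \<rho> (Suc i), fst \<rho> i)"
    using assms(1) unfolding is_ray_def by auto
  have "i = j" if "snd \<rho> i = snd \<rho> j" for i j
    using ends[of i] ends[of j] inj unfolding that by (auto simp: inj_eq)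
  then have "finite (snd \<rho> -` F)" using assms(2) by (intro finite_vimageI) (auto simp: inj_def)
  then obtain n where "\<forall>k\<in>snd \<rho> -` F. k < n" using finite_nat_set_iff_bounded by blast
  then have "snd \<rho> k \<notin> F" if "k \<ge> n" for k using that by (meson leD vimageI2)
  then show thesis by (rule that)
qed

lemma ray_linked:
  assumes "is_ray G \<rho>" "\<And>k. k \<ge> n \<Longrightarrow> snd \<rho> k \<notin> F" "n \<le> m"
  shows "(adj_avoid G F)\<^sup>*\<^sup>* (fst \<rho> n) (fst \<rho> m)"
  using assms(3)
proof (induction m rule: dec_induct)
  case (step m)
  then have "adj_avoid G F (fst \<rho> m) (fst \<rho> (Suc m))"
    using assms(1,2) unfolding is_ray_def adj_avoid_def by blast
  then show ?case using step.IH by simp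
qed simp

text \<open>An edge-end lies on one side of a finite cut. Both rays are compared with the
  representative \<open>\<sigma>\<close> of the end, whose tail beyond the cut stays on one
  side.\<close>

lemma end_side:
  assumes "\<omega> \<in> edge_ends G" "\<rho> \<in> \<omega>" "\<rho>' \<in> \<omega>" and fin: "finite (cut G A)"
    and A: "\<And>i. fst \<rho> i \<in> A" "\<And>i. fst \<rho>' i \<notin> A"
  shows False
proof -
  obtain \<sigma> where \<sigma>: "is_ray G \<sigma>" "ray_equiv G \<sigma> \<rho>" "ray_equiv G \<sigma> \<rho>'"
    using assms(1-3) unfolding edge_ends_def by auto
  have inv: "u \<in> A \<longleftrightarrow> v \<in> A" if "(adj_avoid G (cut G A))\<^sup>*\<^sup>* u v" for u v
    using linked_cut[of G "- cut G A" u v A] that by simp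
  obtain n m where n: "\<And>k. k \<ge> n \<Longrightarrow> snd \<sigma> k \<notin> cut G A" "(adj_avoid G (cut G A))\<^sup>*\<^sup>* (fst \<sigma> n) (fst \<rho> m)"
    using \<sigma>(2) fin cut_subset_edges unfolding ray_equiv_def by metis
  obtain n' m' where n': "\<And>k. k \<ge> n' \<Longrightarrow> snd \<sigma> k \<notin> cut G A" "(adj_avoid G (cut G A))\<^sup>*\<^sup>* (fst \<sigma> n') (fst \<rho>' m')"
    using \<sigma>(3) fin cut_subset_edges unfolding ray_equiv_def by metis
  have "fst \<sigma> n \<in> A \<longleftrightarrow> fst \<sigma> (max n n') \<in> A" "fst \<sigma> n' \<in> A \<longleftrightarrow> fst \<sigma> (max n n') \<in> A"
    by (intro inv ray_linked[OF \<sigma>(1)] n(1) n'(1); simp)+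
  then show False using inv[OF n(2)] inv[OF n'(2)] A by simp
qed

text \<open>A tail of a ray of the end avoids the finitely many edges carrying points of
  \<open>Z\<close>. Its closed edges are connected, miss \<open>Z\<close> and overlap successively
  in vertices, so one piece contains the whole tail.\<close>

lemma end_in_piece:
  assumes wf: "wf_graph G" and \<omega>: "\<omega> \<in> edge_ends G" and Z: "finite Z" "Z \<subseteq> inner_points G"
  obtains C where "C \<in> pieces G Z" "PEnd \<omega> \<in> hat G C"
proof -
  obtain \<sigma> where \<sigma>: "is_ray G \<sigma>" "\<omega> = {\<rho>. is_ray G \<rho> \<and> ray_equiv G \<sigma> \<rho>}"
    using \<omega> unfolding edge_ends_def by auto
  define F where "F = (\<lambda>x. case x of PE e t \<Rightarrow> e) ` Z"
  have FZ: "PE e t \<notin> Z" if "e \<notin> F" for e t using that by (force simp: F_def)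
  obtain n where n: "\<And>k. k \<ge> n \<Longrightarrow> snd \<sigma> k \<notin> F"
    using ray_avoids_finite[OF \<sigma>(1), of F] Z(1) unfolding F_def by blast
  define \<rho> where "\<rho> = ((\<lambda>i. fst \<sigma> (n + i)), (\<lambda>i. snd \<sigma> (n + i)))"
  have ray: "is_ray G \<rho>" using \<sigma>(1) unfolding is_ray_def \<rho>_def by (auto intro!: injI dest: injD)
  have "ray_equiv G \<sigma> \<rho>" unfolding ray_equiv_def
  proof (intro allI impI)
    fix F' assume F': "finite F' \<and> F' \<subseteq> edges G"
    obtain k where k: "\<And>i. i \<ge> k \<Longrightarrow> snd \<sigma> i \<notin> F'" using ray_avoids_finite[OF \<sigma>(1)] F' by blast
    \<comment> \<open>With the index shifted by \<open>n\<close>, both rays are at the same vertex,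
      so the trivial walk links them.\<close>
    have "fst \<sigma> (n + k) = fst \<rho> k" by (simp add: \<rho>_def)
    moreover have "\<forall>i\<ge>n + k. snd \<sigma> i \<notin> F'" "\<forall>i\<ge>k. snd \<rho> i \<notin> F'" using k by (auto simp: \<rho>_def)
    ultimately show "\<exists>n m. (\<forall>k\<ge>n. snd \<sigma> k \<notin> F') \<and> (\<forall>k\<ge>m. snd \<rho> k \<notin> F') \<and>
        (adj_avoid G F')\<^sup>*\<^sup>* (fst \<sigma> n) (fst \<rho> m)"
      by (metis rtranclp.rtrancl_refl)
  qed
  then have mem: "\<rho> \<in> \<omega>" using ray \<sigma>(2) by simp
  have vert: "PV (fst \<rho> i) \<in> XH G - Z" for i
    using ray Z(2) by (auto simp: is_ray_def XH_def inner_points_def)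
  obtain C where C: "C \<in> pieces G Z" "PV (fst \<rho> 0) \<in> C"
    using piece_obtain[OF wf] vert[of 0] by blast
  define K where "K i = edge_map G (snd \<rho> i) ` {0..1}" for i
  have eK: "snd \<rho> i \<in> edges G" "snd \<rho> i \<notin> F" for i
    using ray n by (auto simp: is_ray_def \<rho>_def)
  have "connectedin (XH_top G) (K i)" for i
    unfolding K_def
    by (rule connectedin_continuous_map_image[OF continuous_map_edge_map[OF wf eK(1)]])
      (simp add: connectedin_subtopology)
  moreover have "K i \<subseteq> XH G - Z" for i
  proof -
    have "edge_map G (snd \<rho> i) t \<notin> Z" for t
      using FZ[OF eK(2)[of i]] Z(2) by (auto simp: edge_map_def inner_points_def)
    then show ?thesis unfolding K_def using edge_map_in_XH[OF wf eK(1)] by blast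
  qed
  ultimately have sub: "K i \<subseteq> C" if "x \<in> C" "x \<in> K i" for x i
    using piece_maximal[OF C(1)] that by blast
  have "PV (fst (ends G (snd \<rho> i))) \<in> K i" "PV (snd (ends G (snd \<rho> i))) \<in> K i" for i
    unfolding K_def by (force simp: edge_map_def)+
  then have endsK: "PV (fst \<rho> i) \<in> K i" "PV (fst \<rho> (Suc i)) \<in> K i" for i
    using ray unfolding is_ray_def by (metis fst_conv snd_conv)+
  have inC: "PV (fst \<rho> i) \<in> C" for i
  proof (induction i)
    case (Suc i)
    then show ?case using sub endsK by blast
  qed (rule C)
  have "PE (snd \<rho> i) t \<in> C" if "0 < t" "t < 1" for i t
  proof -
    have "PE (snd \<rho> i) t \<in> K i" using that by (force simp: K_def edge_map_def)
    then show ?thesis using sub[OF inC endsK(1)] by blast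
  qed
  then have "ray_points G \<rho> \<subseteq> C" using inC by (auto simp: ray_points_def)
  then have "PEnd \<omega> \<in> hat G C" using mem \<omega> by (auto simp: hat_def)
  then show thesis using that C(1) by blast
qed

text \<open>Stereographic projection identifies the punctured circle with a line, which is
  convex.\<close>

lemma connected_punctured_circle: "a \<in> sphere (0::complex) 1 \<Longrightarrow> connected (sphere 0 1 - {a})"
  using homeomorphic_connectedness[OF homeomorphic_punctured_sphere_hyperplane[of 1 a 0 1 0]]
    convex_connected[OF convex_hyperplane[of "1::complex" 0]]
  by simp

lemma PE_in_XH: "PE e t \<in> XH G \<longleftrightarrow> e \<in> edges G \<and> 0 < t \<and> t < 1"
  by (auto simp: XH_def inner_points_def)

lemma PE_in_side: "PE e t \<in> side G \<tau> A \<longleftrightarrow> e \<in> edges G \<and> 0 < t \<and> t < 1 \<and>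
     (if t < \<tau> e then fst (ends G e) \<in> A
      else if t > \<tau> e then snd (ends G e) \<in> A
      else fst (ends G e) \<in> A \<and> snd (ends G e) \<in> A)"
  by (auto simp: side_def)

text \<open>A circle may run through infinitely many edges and through edge-ends, so counting is
  replaced by connectedness of the circle minus a point.\<close>

lemma circle_Int_finite_cut:
  assumes wf: "wf_graph G" and fin: "finite (cut G A)" and S: "is_circle G S"
  shows "circle_edges G S \<inter> cut G A \<noteq> {e}"
proof
  assume eq: "circle_edges G S \<inter> cut G A = {e}"
  then have e: "e \<in> cut G A" "\<And>t. 0 < t \<Longrightarrow> t < 1 \<Longrightarrow> PE e t \<in> S"
    by (auto simp: circle_edges_def)
  \<comment> \<open>A cut edge other than \<open>e\<close> has an inner point outside
    \<open>S\<close>, which is chosen; all other edges get their midpoint. The chosen cut points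
    then meet \<open>S\<close> at most in the midpoint of \<open>e\<close>.\<close>
  have "\<exists>t. 0 < t \<and> t < 1 \<and> (d \<in> cut G A \<longrightarrow> PE d t \<in> S \<longrightarrow> d = e \<and> t = 1/2)" for d
  proof (cases "d \<in> cut G A \<and> d \<noteq> e")
    case True
    then have "d \<in> edges G" "d \<notin> circle_edges G S" using eq by (auto simp: cut_def)
    then show ?thesis by (auto simp: circle_edges_def)
  qed (auto intro!: exI[of _ "1/2"])
  then obtain \<tau> where \<tau>: "\<And>d. 0 < \<tau> d \<and> \<tau> d < 1"
    and \<tau>S: "\<And>d. d \<in> cut G A \<Longrightarrow> PE d (\<tau> d) \<in> S \<Longrightarrow> d = e \<and> \<tau> d = (1/2::real)"
    by metis
  define x where "x = (PE e (1/2) :: ('a, 'b) pt)"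
  define Z where "Z = (\<lambda>e. (PE e (\<tau> e) :: ('a, 'b) pt)) ` cut G A"
  have Z: "finite Z" "Z \<subseteq> inner_points G"
    using fin cut_points[of \<tau>, OF \<tau>] by (auto simp: Z_def)
  have ZS: "Z \<inter> S \<subseteq> {x}" using \<tau>S by (auto simp: Z_def x_def)
  have xS: "x \<in> S" using e(2) by (simp add: x_def)
  have te: "\<tau> e = 1/2" using \<tau>S[OF e(1)] e(2) \<tau>[of e] by blast
  \<comment> \<open>The open part of \<open>absG G\<close> on the \<open>B\<close>-side. Unlike
    \<open>side\<close>, it includes the edge-ends.\<close>
  define Ob where "Ob B = \<Union>{hat G C | C. C \<in> pieces G Z \<and> C \<subseteq> side G \<tau> B}" for B
  have open_Ob: "openin (absG G) (Ob B)" for B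
    unfolding Ob_def using openin_hat[OF Z] by (intro openin_Union) auto
  have split: "C \<subseteq> side G \<tau> A \<or> C \<subseteq> side G \<tau> (- A)" if "C \<in> pieces G Z" for C
    by (rule piece_split[OF that openin_side[OF wf] openin_side[OF wf] side_disjoint])
      (use \<tau> side_cover[of G \<tau> A] in \<open>auto simp: Z_def\<close>)
  have cover: "y \<in> Ob A \<union> Ob (- A)" if "y \<in> S - {x}" for y
  proof -
    have "y \<in> XH G \<union> PEnd ` edge_ends G" "y \<notin> Z"
      using that S absG_subset[of G] ZS unfolding is_circle_def by auto
    then have "\<exists>C. C \<in> pieces G Z \<and> y \<in> hat G C"
    proof (elim UnE imageE)
      assume "y \<in> XH G"
      then obtain C where "C \<in> pieces G Z" "y \<in> C" using piece_obtain[OF wf _ \<open>y \<notin> Z\<close>] by metis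
      then show ?thesis using subset_hat by (metis subsetD)
    next
      fix \<omega> assume "y = PEnd \<omega>" "\<omega> \<in> edge_ends G"
      then show ?thesis using end_in_piece[OF wf _ Z] by metis
    qed
    then obtain C where "C \<in> pieces G Z" "y \<in> hat G C" by auto
    then show ?thesis using split unfolding Ob_def by blast
  qed
  have Ob_XH: "Ob B \<inter> XH G \<subseteq> side G \<tau> B" for B
    unfolding Ob_def using hat_Int_XH[of G] by blast
  \<comment> \<open>At inner points and vertices the sides are disjoint; a common edge-end would
    have rays on both sides of the finite cut.\<close>
  have disj: "Ob A \<inter> Ob (- A) = {}"
  proof (rule ccontr)
    assume "Ob A \<inter> Ob (- A) \<noteq> {}"
    then obtain y C D where y: "y \<in> hat G C" "C \<subseteq> side G \<tau> A" "y \<in> hat G D" "D \<subseteq> side G \<tau> (- A)"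
      unfolding Ob_def by blast
    have vert: "fst \<rho> i \<in> B" if "ray_points G \<rho> \<subseteq> side G \<tau> B" for \<rho> i B
      using that by (auto simp: ray_points_def side_def)
    show False
    proof (cases "\<exists>\<omega>. y = PEnd \<omega>")
      case True
      then obtain \<omega> where \<omega>: "y = PEnd \<omega>" by blast
      have nC: "y \<notin> C" "y \<notin> D" using \<omega> y(2,4) by (auto simp: side_def)
      then obtain \<rho> \<rho>' where r: "\<omega> \<in> edge_ends G" "\<rho> \<in> \<omega>" "\<rho>' \<in> \<omega>" "ray_points G \<rho> \<subseteq> C" "ray_points G \<rho>' \<subseteq> D"
        using y(1,3) \<omega> by (auto simp: hat_def)
      show False
      proof (rule end_side[OF r(1-3) fin])
        show "fst \<rho> i \<in> A" for i using vert[of \<rho> A] r(4) y(2) by blast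
        show "fst \<rho>' i \<notin> A" for i using vert[of \<rho>' "- A" i] r(5) y(4) by blast
      qed
    next
      case False
      then have "y \<in> C" "y \<in> D" using y by (auto simp: hat_def)
      then show False using y(2,4) side_disjoint by blast
    qed
  qed
  have eE: "e \<in> edges G" using e(1) by (simp add: cut_def)
  \<comment> \<open>Points of \<open>e\<close> before and after its cut point lie on different
    sides, so both open sets meet the punctured circle.\<close>
  have quarter: "PE e (1/4) \<in> S - {x}" "PE e (3/4) \<in> S - {x}" "PE e (1/4) \<in> XH G" "PE e (3/4) \<in> XH G"
    using e(2)[of "1/4"] e(2)[of "3/4"] eE by (simp_all add: x_def PE_in_XH)
  have "PE e (1/4) \<in> side G \<tau> A \<longleftrightarrow> fst (ends G e) \<in> A" "PE e (3/4) \<in> side G \<tau> A \<longleftrightarrow> snd (ends G e) \<in> A"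
    "PE e (1/4) \<in> side G \<tau> (- A) \<longleftrightarrow> fst (ends G e) \<notin> A" "PE e (3/4) \<in> side G \<tau> (- A) \<longleftrightarrow> snd (ends G e) \<notin> A"
    using eE te by (simp_all add: PE_in_side)
  moreover have "(fst (ends G e) \<in> A) \<noteq> (snd (ends G e) \<in> A)" using e(1) by (simp add: cut_def)
  ultimately have ne: "Ob A \<inter> (S - {x}) \<noteq> {}" "Ob (- A) \<inter> (S - {x}) \<noteq> {}"
    using cover[OF quarter(1)] cover[OF quarter(2)] quarter Ob_XH[of A] Ob_XH[of "- A"] by blast+
  obtain f g where fg: "homeomorphic_maps (subtopology (absG G) S) (top_of_set (sphere (0::complex) 1)) f g"
    using S unfolding is_circle_def homeomorphic_space_def by blast
  have top: "topspace (subtopology (absG G) S) = S" using S unfolding is_circle_def by auto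
  have fx: "f x \<in> sphere 0 1" "\<And>y. y \<in> S \<Longrightarrow> f y \<in> sphere 0 1" "\<And>y. y \<in> S \<Longrightarrow> g (f y) = y"
    "\<And>z. z \<in> sphere 0 1 \<Longrightarrow> f (g z) = z" "\<And>z. z \<in> sphere 0 1 \<Longrightarrow> g z \<in> S"
    using fg xS unfolding homeomorphic_maps_def continuous_map_def top by (auto simp: Pi_iff)
  have "g ` (sphere 0 1 - {f x}) = S - {x}"
  proof (intro subset_antisym subsetI)
    fix y assume y: "y \<in> S - {x}"
    then have "f y \<noteq> f x" using fx(3)[of y] fx(3)[OF xS] by auto
    then show "y \<in> g ` (sphere 0 1 - {f x})" using y fx(2,3) by (intro image_eqI[of _ _ "f y"]) simp_all
  next
    fix y assume "y \<in> g ` (sphere 0 1 - {f x})"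
    then obtain z where z: "y = g z" "z \<in> sphere 0 1" "z \<noteq> f x" by blast
    then show "y \<in> S - {x}" using fx(4,5)[OF z(2)] by auto
  qed
  moreover have "connectedin (top_of_set (sphere (0::complex) 1)) (sphere 0 1 - {f x})"
    using connected_punctured_circle[OF fx(1)] by (auto simp: connectedin_subtopology)
  ultimately have "connectedin (subtopology (absG G) S) (S - {x})"
    using connectedin_continuous_map_image fg unfolding homeomorphic_maps_def by metis
  then have "connectedin (absG G) (S - {x})" by (simp add: connectedin_subtopology)
  then show False using connectedinD[OF _ open_Ob open_Ob] cover disj ne by blast
qed

section \<open>Finite cycles are circles\<close>

text \<open>The interval from 0 to \<open>n\<close> is wrapped along the closed path, one edge per
  unit. Identifying its ends turns this into a continuous bijection from the circle onto a Hausdorff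
  space, hence a homeomorphism.\<close>

lemma closed_path_circle:
  assumes wf: "wf_graph G" and fs: "finitely_separable G" and cp: "closed_path G p q n"
  obtains S where "is_circle G S" "circle_edges G S = q ` {..<n}"
proof -
  have n: "0 < n" "p n = p 0" "inj_on p {..<n}" "inj_on q {..<n}"
    and js: "\<And>i. i < n \<Longrightarrow> joins G (q i) (p i) (p (Suc i))"
    using cp unfolding closed_path_def by auto
  \<comment> \<open>Local parameter on edge \<open>i\<close>, reversed when the path traverses the
    edge from second end to first.\<close>
  define \<theta> where "\<theta> i s = (if ends G (q i) = (p i, p (Suc i)) then s - real i else 1 - (s - real i))" for i s
  define h where "h i s = edge_map G (q i) (\<theta> i s)" for i s
  have h0: "h i (real i) = PV (p i)" and h1: "h i (real i + 1) = PV (p (Suc i))" if "i < n" for i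
    using js[OF that] by (auto simp: h_def \<theta>_def edge_map_def joins_def)
  have hin: "h i s = PE (q i) (\<theta> i s)" "0 < \<theta> i s" "\<theta> i s < 1" if "real i < s" "s < real i + 1" for i s
    using that by (auto simp: h_def \<theta>_def edge_map_def)
  have "\<exists>g. continuous_map (top_of_set {0..real n}) (absG G) g \<and>
      (\<forall>i<n. \<forall>s\<in>{real i..real i + 1}. g s = h i s)"
  proof (rule pasting_lemma_exists_closed[of "{..<n}" "top_of_set {0..real n}" "\<lambda>i. {real i..real i + 1}" "absG G" h])
    show "topspace (top_of_set {0..real n}) \<subseteq> (\<Union>i<n. {real i..real i + 1})"
    proof
      fix s assume "s \<in> topspace (top_of_set {0..real n})"
      then have s: "0 \<le> s" "s \<le> real n" by auto
      show "s \<in> (\<Union>i<n. {real i..real i + 1})"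
      proof (cases "s = real n")
        case True
        \<comment> \<open>At the right end the floor would give the index \<open>n\<close>, one too
          large.\<close>
        then show ?thesis using n(1) by (intro UN_I[of "n - 1"]) (auto simp: of_nat_diff)
      next
        case False
        then have "nat \<lfloor>s\<rfloor> < n" using s by linarith
        moreover have "real (nat \<lfloor>s\<rfloor>) \<le> s \<and> s \<le> real (nat \<lfloor>s\<rfloor>) + 1" using s by linarith
        ultimately show ?thesis by (intro UN_I[of "nat \<lfloor>s\<rfloor>"]) simp_all
      qed
    qed
  next
    fix i assume i: "i \<in> {..<n}"
    then have sub: "{real i..real i + 1} \<subseteq> {0..real n}" by auto
    show "closedin (top_of_set {0..real n}) {real i..real i + 1}"
      using sub by (intro closed_subset) auto
    have e: "q i \<in> edges G" using js i by (auto simp: joins_def)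
    have "continuous_map (top_of_set {real i..real i + 1}) (top_of_set {0..1}) (\<theta> i)"
      unfolding \<theta>_def by (auto simp: continuous_map_in_subtopology intro!: continuous_intros)
    then have "continuous_map (top_of_set {real i..real i + 1}) (absG G) ((\<lambda>x. x) \<circ> (edge_map G (q i) \<circ> \<theta> i))"
      by (intro continuous_map_compose[OF continuous_map_compose[OF _ continuous_map_edge_map[OF wf e]]
            continuous_map_XH_absG[OF wf]])
    moreover have "(\<lambda>x. x) \<circ> (edge_map G (q i) \<circ> \<theta> i) = h i" by (auto simp: h_def)
    ultimately show "continuous_map (subtopology (top_of_set {0..real n}) {real i..real i + 1}) (absG G) (h i)"
      using sub by (simp add: subtopology_subtopology inf_absorb2)
  next
    fix i j s assume ij: "i \<in> {..<n}" "j \<in> {..<n}"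
      and s: "s \<in> topspace (top_of_set {0..real n}) \<inter> {real i..real i + 1} \<inter> {real j..real j + 1}"
    then have "real i \<le> s" "s \<le> real i + 1" "real j \<le> s" "s \<le> real j + 1" by auto
    \<comment> \<open>Distinct unit intervals overlap only at a common integer, where both maps give
      the same vertex.\<close>
    then have "i = j \<or> j = Suc i \<and> s = real i + 1 \<or> i = Suc j \<and> s = real j + 1" by linarith
    then consider "i = j" | "j = Suc i" "s = real i + 1" | "i = Suc j" "s = real j + 1" by blast
    then show "h i s = h j s"
      using h0[of i] h1[of i] h0[of j] h1[of j] ij by cases (auto simp: add.commute)
  next
    fix g assume g: "continuous_map (top_of_set {0..real n}) (absG G) g"
      "\<And>s i. i \<in> {..<n} \<Longrightarrow> s \<in> topspace (top_of_set {0..real n}) \<inter> {real i..real i + 1} \<Longrightarrow> g s = h i s"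
    have "g s = h i s" if "i < n" "s \<in> {real i..real i + 1}" for i s
      using that by (intro g(2)) auto
    then show ?thesis using g(1) by blast
  qed auto
  then obtain g where g: "continuous_map (top_of_set {0..real n}) (absG G) g"
    and gh: "\<And>i s. i < n \<Longrightarrow> real i \<le> s \<Longrightarrow> s \<le> real i + 1 \<Longrightarrow> g s = h i s" by auto
  have g0: "g (real i) = PV (p i)" if "i < n" for i using gh[OF that, of "real i"] h0[OF that] by simp
  have gn: "g (real n) = g 0"
    using gh[of "n - 1" "real n"] h1[of "n - 1"] g0[of 0] n(1,2) by (simp add: of_nat_diff)
  have gin: "g s = PE (q i) (\<theta> i s)" if "i < n" "real i < s" "s < real i + 1" for i s
    using gh[OF that(1), of s] hin(1)[OF that(2,3)] that by simp
  have floor: "\<exists>i<n. real i \<le> s \<and> s < real i + 1" if "0 \<le> s" "s < real n" for s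
    using that by (intro exI[of _ "nat \<lfloor>s\<rfloor>"]) linarith
  have inj: "s = s'" if s: "0 \<le> s" "s < real n" and s': "0 \<le> s'" "s' < real n" and eq: "g s = g s'" for s s'
  proof -
    obtain i where i: "i < n" "real i \<le> s" "s < real i + 1" using floor[OF s] by blast
    obtain j where j: "j < n" "real j \<le> s'" "s' < real j + 1" using floor[OF s'] by blast
    show ?thesis
    proof (cases "s = real i")
      case True
      then have "s' = real j" using eq g0[OF i(1)] gin[OF j(1), of s'] j by force
      then show ?thesis using True eq g0 i(1) j(1) n(3) by (auto dest: inj_onD)
    next
      case False
      then have gs: "g s = PE (q i) (\<theta> i s)" using gin i by simp
      then have "s' \<noteq> real j" using eq g0[OF j(1)] by auto
      then have "q i = q j" "\<theta> i s = \<theta> j s'" using gs gin[OF j(1), of s'] j eq by auto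
      moreover have "i = j" using inj_onD[OF n(4) \<open>q i = q j\<close>] i j by simp
      ultimately show ?thesis by (simp add: \<theta>_def split: if_splits)
    qed
  qed
  define c where "c s = cis (2 * pi * s / real n)" for s
  have c_surj: "\<exists>s. 0 \<le> s \<and> s < real n \<and> c s = z" if "z \<in> sphere 0 1" for z
  proof -
    have "z = cis (Arg2pi z)" "0 \<le> Arg2pi z" "Arg2pi z < 2 * pi"
      using Arg2pi[of z] that by (auto simp: is_Arg_def cis_conv_exp mult.commute)
    then show ?thesis using n(1)
      by (intro exI[of _ "Arg2pi z * real n / (2 * pi)"]) (auto simp: c_def field_simps)
  qed
  have c_eq: "s = s' \<or> {s, s'} = {0, real n}" if "s \<in> {0..real n}" "s' \<in> {0..real n}" "c s = c s'" for s s'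
  proof -
    have "sin (2 * pi * s / real n) = sin (2 * pi * s' / real n) \<and> cos (2 * pi * s / real n) = cos (2 * pi * s' / real n)"
      using that(3) by (simp add: c_def complex_eq_iff)
    then obtain k :: int where "2 * pi * s / real n = 2 * pi * s' / real n + 2 * pi * k"
      unfolding sin_cos_eq_iff by blast
    then have "2 * pi * s = 2 * pi * (s' + k * real n)" using n(1) by (simp add: field_simps)
    then have k: "s = s' + k * real n" by simp
    \<comment> \<open>Both parameters lie in an interval of length \<open>n\<close>, so they differ
      by at most one period.\<close>
    have "\<bar>k * real n\<bar> \<le> real n" using k that(1,2) by auto
    then have "\<bar>real_of_int k\<bar> \<le> 1" using n(1) by (simp add: abs_mult)
    then have "k = 0 \<or> k = 1 \<or> k = -1" by linarith
    then show ?thesis using k that(1,2) by auto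
  qed
  \<comment> \<open>A continuous surjection from a compact onto a Hausdorff space is a quotient map;
    \<open>g\<close> is constant on the fibres of \<open>c\<close> and so factors through the
    circle.\<close>
  have "quotient_map (top_of_set {0..real n}) (top_of_set (sphere 0 1)) c"
  proof (rule T1_Spaces.continuous_imp_quotient_map)
    show "continuous_map (top_of_set {0..real n}) (top_of_set (sphere 0 1)) c"
      using n(1) unfolding c_def by (auto simp: continuous_map_in_subtopology intro!: continuous_intros)
    show "compact_space (top_of_set {0..real n})" by (simp add: compact_space_subtopology)
    show "Hausdorff_space (top_of_set (sphere (0::complex) 1))"
      by (simp add: Hausdorff_space_subtopology)
    show "c ` topspace (top_of_set {0..real n}) = topspace (top_of_set (sphere 0 1))"
      using c_surj by (force simp: c_def)
  qed
  moreover have "g s = g s'" if "s \<in> {0..real n}" "s' \<in> {0..real n}" "c s = c s'" for s s'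
    using c_eq[OF that] gn by (auto simp: doubleton_eq_iff)
  ultimately obtain k where k: "continuous_map (top_of_set (sphere 0 1)) (absG G) k"
      "k ` sphere 0 1 = g ` {0..real n}" "\<And>s. s \<in> {0..real n} \<Longrightarrow> k (c s) = g s"
    by (rule quotient_map_lift_exists[OF _ g, of "top_of_set (sphere 0 1)" c]) simp_all
  define S where "S = g ` {0..real n}"
  \<comment> \<open>Every point has a parameter below \<open>n\<close>, the range in which
    \<open>floor\<close> and \<open>inj\<close> apply.\<close>
  have S: "S = g ` {0..<real n}"
  proof -
    have "{0..real n} = insert (real n) {0..<real n}" by auto
    then show ?thesis using gn n(1) by (auto simp: S_def)
  qed
  have SX: "S \<subseteq> XH G"
  proof
    fix x assume "x \<in> S"
    then obtain s where s: "0 \<le> s" "s < real n" "x = g s" unfolding S by auto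
    obtain i where i: "i < n" "real i \<le> s" "s < real i + 1" using floor[OF s(1,2)] by blast
    have "q i \<in> edges G" using js[OF i(1)] by (simp add: joins_def)
    then show "x \<in> XH G" unfolding s(3) gh[OF i(1,2) less_imp_le[OF i(3)]] h_def
      using i by (intro edge_map_in_XH[OF wf]) (auto simp: \<theta>_def)
  qed
  have ST: "S \<subseteq> topspace (absG G)" using SX XH_subset_absG[OF wf] by blast
  have "homeomorphic_map (top_of_set (sphere 0 1)) (subtopology (absG G) S) k"
  proof (rule continuous_imp_homeomorphic_map)
    show "continuous_map (top_of_set (sphere 0 1)) (subtopology (absG G) S) k"
      using k(1,2) by (auto simp: continuous_map_in_subtopology S_def)
    show "compact_space (top_of_set (sphere (0::complex) 1))" by (simp add: compact_space_subtopology)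
    show "Hausdorff_space (subtopology (absG G) S)" by (rule Hausdorff_absG_XH[OF wf fs SX])
    show "k ` topspace (top_of_set (sphere 0 1)) = topspace (subtopology (absG G) S)"
      using k(2) ST by (simp add: S_def inf_absorb2)
    show "inj_on k (topspace (top_of_set (sphere 0 1)))"
    proof (rule inj_onI)
      fix z z' assume z: "z \<in> topspace (top_of_set (sphere 0 1))" "z' \<in> topspace (top_of_set (sphere 0 1))" "k z = k z'"
      obtain s where s: "0 \<le> s" "s < real n" "c s = z" using c_surj z(1) by auto
      obtain s' where s': "0 \<le> s'" "s' < real n" "c s' = z'" using c_surj z(2) by auto
      have "g s = g s'" using k(3)[of s] k(3)[of s'] s s' z(3) by simp
      then show "z = z'" using inj[OF s(1,2) s'(1,2)] s(3) s'(3) by simp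
    qed
  qed
  then have "is_circle G S" unfolding is_circle_def
    using ST homeomorphic_space_sym homeomorphic_map_imp_homeomorphic_space by blast
  moreover have "circle_edges G S = q ` {..<n}"
  proof (intro subset_antisym subsetI)
    fix e assume "e \<in> circle_edges G S"
    then have "PE e (1/2) \<in> S" by (simp add: circle_edges_def)
    then obtain s where s: "0 \<le> s" "s < real n" "g s = PE e (1/2)" unfolding S by force
    obtain i where i: "i < n" "real i \<le> s" "s < real i + 1" using floor[OF s(1,2)] by blast
    have "s \<noteq> real i" using s(3) g0[OF i(1)] by auto
    then have "e = q i" using gin[OF i(1), of s] i s(3) by simp
    then show "e \<in> q ` {..<n}" using i by simp
  next
    fix e assume "e \<in> q ` {..<n}"
    then obtain i where i: "i < n" "e = q i" by auto
    have "PE e t \<in> S" if "0 < t" "t < 1" for t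
    proof -
      \<comment> \<open>This inverts \<open>\<theta> i\<close>, in either orientation of the
        edge.\<close>
      define s where "s = (if ends G (q i) = (p i, p (Suc i)) then real i + t else real i + (1 - t))"
      have s: "real i < s" "s < real i + 1" using that by (auto simp: s_def)
      have "\<theta> i s = t" by (simp add: \<theta>_def s_def)
      then have "g s = PE e t" using gin[OF i(1) s] i(2) by simp
      then show ?thesis unfolding S_def using s i(1) by (intro image_eqI[of _ _ s]) auto
    qed
    then show "e \<in> circle_edges G S" using js[OF i(1)] i(2) by (auto simp: circle_edges_def joins_def)
  qed
  ultimately show thesis by (rule that)
qed

section \<open>Dual graphs\<close>

text \<open>Uses duality from circles of \<open>G\<close> to bonds of \<open>G'\<close>. Finite
  separability of \<open>G\<close> enters through \<open>closed_path_circle\<close>.\<close>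

lemma finite_cycle_contains_bond:
  assumes wf: "wf_graph G" "wf_graph G'" and fs: "finitely_separable G"
    and dual: "is_dual_id G G'" and C: "is_finite_cycle G' F"
  obtains D where "is_bond G D" "finite D" "D \<subseteq> F"
proof -
  have eE: "edges G = edges G'" using dual by (simp add: is_dual_id_def)
  have F: "finite F" "F \<subseteq> edges G" using C eE by (auto simp: is_finite_cycle_def)
  obtain e where e: "e \<in> F" using C by (auto simp: is_finite_cycle_def)
  have "\<not> linked G (edges G - F) (fst (ends G e)) (snd (ends G e))"
  proof
    assume l: "linked G (edges G - F) (fst (ends G e)) (snd (ends G e))"
    have "edges G - F - {e} = edges G - F" using e by auto
    then obtain p q n where cp: "closed_path G p q n" "e \<in> q ` {..<n}" "q ` {..<n} \<subseteq> insert e (edges G - F)"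
      using linked_imp_closed_path[of e G "edges G - F"] l e F(2) by (metis subsetD)
    obtain S where S: "is_circle G S" "circle_edges G S = q ` {..<n}"
      using closed_path_circle[OF wf(1) fs cp(1)] .
    have "q ` {..<n} \<subseteq> edges G" using S(2) by (auto simp: circle_edges_def)
    then have "is_bond G' (q ` {..<n})" using dual S unfolding is_dual_id_def by blast
    moreover have "F \<inter> q ` {..<n} = {e}" using e cp(2,3) by auto
    ultimately show False using finite_cycle_cut[OF wf(2) C] by (auto simp: is_bond_def)
  qed
  then obtain D where "is_bond G D" "D \<subseteq> F" using bond_if_unlinked[OF wf(1) F(2) e] by blast
  then show thesis using that F(1) finite_subset by blast
qed

text \<open>Uses duality from bonds of \<open>G'\<close> to circles of \<open>G\<close>. The
  fundamental bond may be infinite, so its circle need not be a finite cycle.\<close>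

lemma finite_bond_not_M_FC:
  assumes wf: "wf_graph G" "wf_graph G'" and dual: "is_dual_id G G'"
    and F: "is_bond G F" "finite F"
  shows "F \<notin> M_FC G'"
proof
  assume FC: "F \<in> M_FC G'"
  obtain A where A: "F = cut G A" using F(1) by (auto simp: is_bond_def is_cut_def)
  obtain e where e: "e \<in> F" using F(1) by (auto simp: is_bond_def)
  obtain T where T: "F \<subseteq> T" "T \<subseteq> edges G'" "spanning G' T" "\<And>f. f \<in> T \<Longrightarrow> bridge G' T f"
    using exists_spanning_forest[OF FC] by blast
  obtain D where D: "is_bond G' D" "D \<inter> T = {e}"
    using fundamental_bond[OF wf(2) T(2,3), of e] T(1,4) e by blast
  have "D \<subseteq> edges G" using bond_subset_edges[OF D(1)] dual by (simp add: is_dual_id_def)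
  then obtain S where S: "is_circle G S" "circle_edges G S = D"
    using dual D(1) unfolding is_dual_id_def by blast
  have "D \<inter> cut G A = {e}" using D(2) T(1) e A by blast
  then show False using circle_Int_finite_cut[OF wf(1) _ S(1), of A e] F(2) A S(2) by simp
qed

theorem theorem3p4:
  fixes G :: "('v, 'e) graph" and G' :: "('w, 'e) graph"
  assumes "wf_graph G" and "wf_graph G'"
    and "countable_graph G" and "countable_graph G'"
    and "finitely_separable G" and "finitely_separable G'"
    and "edges G = edges G'"
    and "is_dual_id G G'"
  shows "M_FB G = dual_indep (edges G) (M_C G)
       \<and> dual_indep (edges G) (M_C G) = dual_indep (edges G') (M_B G')
       \<and> dual_indep (edges G') (M_B G') = M_FC G'"
proof -
  have eE: "edges G = edges G'" by fact
  \<comment> \<open>\<open>is_dual_id\<close> speaks only of subsets of \<open>edges G\<close>, so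
    both sides are first seen to consist of such sets.\<close>
  have "{circle_edges G S | S. is_circle G S} = {D. is_bond G' D}"
  proof (intro subset_antisym subsetI)
    fix F assume "F \<in> {circle_edges G S | S. is_circle G S}"
    then obtain S where S: "is_circle G S" "F = circle_edges G S" by blast
    then have "F \<subseteq> edges G" by (auto simp: circle_edges_def)
    then show "F \<in> {D. is_bond G' D}" using S assms(8) unfolding is_dual_id_def by blast
  next
    fix F assume "F \<in> {D. is_bond G' D}"
    then show "F \<in> {circle_edges G S | S. is_circle G S}"
      using bond_subset_edges[of G' F] assms(8) unfolding is_dual_id_def by blast
  qed
  then have "M_C G = M_B G'" unfolding M_C_def M_B_def eE by simp
  then have eq: "dual_indep (edges G) (M_C G) = dual_indep (edges G') (M_B G')" using eE by simp
  \<comment> \<open>The circuits need not be matched one by one: it suffices that each circuit of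
    either side is dependent on the other.\<close>
  have "M_FB G = M_FC G'"
  proof (intro subset_antisym subsetI)
    fix I assume I: "I \<in> M_FB G"
    have "\<not> C \<subseteq> I" if C: "is_finite_cycle G' C" for C
    proof -
      obtain D where "is_bond G D" "finite D" "D \<subseteq> C"
        using finite_cycle_contains_bond[OF assms(1,2,5,8) C] .
      then show ?thesis using I unfolding M_FB_def indep_of_circuits_def by blast
    qed
    then show "I \<in> M_FC G'"
      using I eE unfolding M_FB_def M_FC_def indep_of_circuits_def by auto
  next
    fix I assume I: "I \<in> M_FC G'"
    have "\<not> D \<subseteq> I" if D: "is_bond G D" "finite D" for D
    proof
      assume "D \<subseteq> I"
      then have "D \<in> M_FC G'" using I unfolding M_FC_def indep_of_circuits_def by blast
      then show False using finite_bond_not_M_FC[OF assms(1,2,8) D] by simp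
    qed
    then show "I \<in> M_FB G"
      using I eE unfolding M_FB_def M_FC_def indep_of_circuits_def by auto
  qed
  then show ?thesis using eq dual_M_B[OF assms(2)] by simp
qed

end
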